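(* Let $X$ be a Lévy process such that $\int_{\mathbb{R}\setminus\{0\}}(x^2\wedge|x|)K_0(dx)<\infty$. For $\alpha\ge1$ consider the condition $$(\mathrm{L}_\alpha)\qquad \text{there exists }\delta>0\text{ such that }\int_{x<-1}e^{-(\alpha+\delta)x}K_0(dx)<\infty .$$ (i) Let $\alpha\ge 1$ be such that $(\mathrm{L}_\alpha)$ holds and $m^{(\alpha)}_\infty<\infty$. Then for every $q>0$ the Laplace–Carson transforms $\hat m^{(\alpha)}_q$ and $\hat m^{(\alpha-1)}_q$ of $m^{(\alpha)}_t$ and $m^{(\alpha-1)}_t$ are well-defined (finite) and $$\hat m^{(\alpha)}_q\,(q+\Phi(\alpha))=\alpha\,\hat m^{(\alpha-1)}_q .$$ (ii) In particular, for an integer $n\ge 1$ such that $(\mathrm{L}_n)$ holds and $m^{(n)}_\infty<\infty$, for every $q>0$ $$\hat m^{(n)}_q=\frac{n!}{\prod_{k=1}^n(q+\Phi(k))},$$ and, as a consequence, $${\bf E}(I_\infty^n)=\frac{n!}{\prod_{k=1}^n\Phi(k)} .$$ (iii) Moreover, if $(\mathrm{L}_n)$ holds for all integers $n\ge1$, all positive moments of $I_\infty$ exist (are finite), and $\beta\ge 0$ is such that the series below converges, then the Laplace transform of $I_\infty$ at $\beta$ is $${\bf E}(e^{-\beta I_\infty})=\sum_{n=0}^\infty\frac{(-1)^n\beta^n}{\prod_{k=1}^n\Phi(k)} .$$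
   Context: $X=(X_t)_{t\ge 0}$ is a real-valued Lévy process, $X_0=0$, with parameters $(b_0,c_0,K_0)$ (drift written without truncation of jumps, Gaussian variance $c_0$, Lévy measure $K_0$). Its Laplace exponent is given by ${\bf E}(e^{-\alpha X_t})=e^{-t\Phi(\alpha)}$, $$\Phi(\alpha)=\alpha b_0-\tfrac12\alpha^2c_0-\int_{\mathbb{R}\setminus\{0\}}(e^{-\alpha x}-1+\alpha x)K_0(dx).$$ $I_t=\int_0^te^{-X_s}ds$, $I_\infty=\int_0^\infty e^{-X_s}ds$, $m^{(\alpha)}_t={\bf E}(I_t^\alpha)$, $m^{(\alpha)}_\infty={\bf E}(I_\infty^\alpha)$. The Laplace–Carson transform of $m^{(\alpha)}_t$ with parameter $q>0$ is $\hat m^{(\alpha)}_q=\int_0^\infty qe^{-qt}m^{(\alpha)}_t\,dt$. Empty products equal $1$. *)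

theory Defs
  imports "HOL-Probability.Probability"
begin

text \<open>
  Time is modelled by the reals, and only times \<open>t \<ge> 0\<close> are constrained. All paths are
  right-continuous with finite left limits and start at 0.
\<close>

locale levy_process = prob_space M
  for M :: "'a measure" +
  fixes X :: "real \<Rightarrow> 'a \<Rightarrow> real"
  assumes measurable_X: "t \<ge> 0 \<Longrightarrow> X t \<in> borel_measurable M"
    and X_0: "\<omega> \<in> space M \<Longrightarrow> X 0 \<omega> = 0"
    and right_continuous: "\<lbrakk>\<omega> \<in> space M; t \<ge> 0\<rbrakk> \<Longrightarrow> continuous (at_right t) (\<lambda>s. X s \<omega>)"
    and left_limits: "\<lbrakk>\<omega> \<in> space M; t > 0\<rbrakk> \<Longrightarrow> \<exists>l. ((\<lambda>s. X s \<omega>) \<longlongrightarrow> l) (at_left t)"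
    and independent_increments:
      "\<lbrakk>mono \<tau>; \<tau> 0 \<ge> 0\<rbrakk> \<Longrightarrow>
        indep_vars (\<lambda>_. borel) (\<lambda>i \<omega>. X (\<tau> (Suc i)) \<omega> - X (\<tau> i) \<omega>) {..<n::nat}"
    and stationary_increments:
      "\<lbrakk>s \<ge> 0; h \<ge> 0\<rbrakk> \<Longrightarrow>
        distr M borel (\<lambda>\<omega>. X (s + h) \<omega> - X s \<omega>) = distr M borel (X h)"

definition levy_measure :: "real measure \<Rightarrow> bool" where
  "levy_measure K \<longleftrightarrow> sets K = sets borel \<and> emeasure K {0} = 0 \<and>
     (\<integral>\<^sup>+x\<in>-{0}. ennreal (min (x\<^sup>2) 1) \<partial>K) < \<infinity>"

text \<open>
  The parameters \<open>(b\<^sub>0, c\<^sub>0, K\<^sub>0)\<close> are those of the Levy--Khintchine formula with the identity as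
  truncation function. The compensated integral in it converges when
  \<open>min (x\<^sup>2) \<bar>x\<bar>\<close> is integrable with respect to \<open>K\<^sub>0\<close>; this is not part of the locale, and
  without it \<open>khintchine\<close> has no meaning.
\<close>

locale levy_process_params = levy_process M X
  for M :: "'a measure" and X :: "real \<Rightarrow> 'a \<Rightarrow> real" +
  fixes b\<^sub>0 c\<^sub>0 :: real and K\<^sub>0 :: "real measure"
  assumes gaussian_variance: "c\<^sub>0 \<ge> 0"
    and levy_measure: "levy_measure K\<^sub>0"
    and khintchine: "t \<ge> 0 \<Longrightarrow>
      char (distr M borel (X t)) u =
        exp (of_real t * (\<i> * of_real (u * b\<^sub>0) - of_real (u\<^sup>2 * c\<^sub>0 / 2) +
          (CLINT x:-{0}|K\<^sub>0. iexp (u * x) - 1 - \<i> * of_real (u * x))))"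

definition laplace_exponent :: "real \<Rightarrow> real \<Rightarrow> real measure \<Rightarrow> real \<Rightarrow> real" where
  "laplace_exponent b c K \<alpha> =
     \<alpha> * b - \<alpha>\<^sup>2 * c / 2 - (LINT x:-{0}|K. exp (- \<alpha> * x) - 1 + \<alpha> * x)"

definition exp_tail_condition :: "real measure \<Rightarrow> real \<Rightarrow> bool" where
  "exp_tail_condition K \<alpha> \<longleftrightarrow>
     (\<exists>\<delta>>0. (\<integral>\<^sup>+x\<in>{..<-1}. ennreal (exp (- (\<alpha> + \<delta>) * x)) \<partial>K) < \<infinity>)"

text \<open>The functionals take values in \<open>[0, \<infinity>]\<close>, since the one over the whole half-line may diverge.\<close>

definition exp_functional :: "(real \<Rightarrow> 'a \<Rightarrow> real) \<Rightarrow> real \<Rightarrow> 'a \<Rightarrow> ennreal" where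
  "exp_functional X t \<omega> = (\<integral>\<^sup>+s\<in>{0..t}. ennreal (exp (- X s \<omega>)) \<partial>lborel)"

definition exp_functional_inf :: "(real \<Rightarrow> 'a \<Rightarrow> real) \<Rightarrow> 'a \<Rightarrow> ennreal" where
  "exp_functional_inf X \<omega> = (\<integral>\<^sup>+s\<in>{0..}. ennreal (exp (- X s \<omega>)) \<partial>lborel)"

text \<open>Meant for exponents \<open>a \<ge> 0\<close>, with \<open>x\<^sup>0 = 1\<close> for all \<open>x\<close> (unlike \<open>0 powr 0 = 0\<close>).\<close>

definition ennreal_powr :: "ennreal \<Rightarrow> real \<Rightarrow> ennreal" where
  "ennreal_powr x a =
     (if a = 0 then 1 else if x = \<infinity> then \<infinity> else ennreal (enn2real x powr a))"

definition moment :: "'a measure \<Rightarrow> (real \<Rightarrow> 'a \<Rightarrow> real) \<Rightarrow> real \<Rightarrow> real \<Rightarrow> ennreal" where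
  "moment M X \<alpha> t = (\<integral>\<^sup>+\<omega>. ennreal_powr (exp_functional X t \<omega>) \<alpha> \<partial>M)"

definition moment_inf :: "'a measure \<Rightarrow> (real \<Rightarrow> 'a \<Rightarrow> real) \<Rightarrow> real \<Rightarrow> ennreal" where
  "moment_inf M X \<alpha> = (\<integral>\<^sup>+\<omega>. ennreal_powr (exp_functional_inf X \<omega>) \<alpha> \<partial>M)"

definition laplace_carson :: "real \<Rightarrow> (real \<Rightarrow> ennreal) \<Rightarrow> ennreal" where
  "laplace_carson q f = (\<integral>\<^sup>+t\<in>{0..}. ennreal (q * exp (- q * t)) * f t \<partial>lborel)"

end

theory Submission
  imports Defs "HOL-Complex_Analysis.Complex_Analysis"
begin

text \<open>
  Write \<open>I\<^sub>t\<close> for \<open>exp_functional X t\<close>. Integrating the derivative of \<open>s \<mapsto> (I\<^sub>t - I\<^sub>s)\<^sup>\<alpha>\<close> and using that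
  \<open>I\<^sub>t - I\<^sub>s\<close> is \<open>exp (- X\<^sub>s)\<close> times a copy of \<open>I\<close> at time \<open>t - s\<close> independent of \<open>X\<^sub>s\<close>, one gets the
  convolution formula \<open>E I\<^sub>t\<^sup>\<alpha> = \<alpha> \<integral>\<^sub>0\<^sup>t E (exp (- \<alpha> X\<^sub>s)) E (I\<^bsub>t-s\<^esub>\<^sup>\<alpha>\<^sup>-\<^sup>1) ds\<close> in \<open>[0, \<infinity>]\<close>, which the
  Laplace-Carson transform turns into a product. Since \<open>E I\<^sub>\<infinity>\<^sup>\<alpha>\<close> is finite, so is \<open>E (exp (- \<alpha> X\<^sub>s))\<close> for
  almost every \<open>s\<close>, and analytic continuation of the Levy-Khintchine formula identifies it as
  \<open>exp (- s \<Phi>(\<alpha>))\<close>. The moments of \<open>I\<^sub>\<infinity>\<close> follow on letting \<open>q \<rightarrow> 0\<close>.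
\<close>

section \<open>Exponential moments from the Levy-Khintchine formula\<close>

text \<open>The Levy-Khintchine formula is given on the imaginary axis only, and continuing it to
  \<alpha> presupposes that \<open>E (exp (- \<alpha> X\<^sub>s))\<close> is finite, which is no
  hypothesis. Hence every probabilistic identity before that point is proved in [0, \<infinity>],
  where nothing has to converge. Finiteness is then read off a product: the transform of order
  \<alpha> is finite and the one of order \<alpha> - 1 is strictly positive, so the third factor,
  the Laplace transform in s of \<open>E (exp (- \<alpha> X\<^sub>s))\<close>, is finite. Its
  convergence also decides the sign of q + \<Phi>(\<alpha>). A second obstacle is that independence
  is given for finitely many increments at a time, while the factor of
  \<open>I\<^sub>t - I\<^sub>s\<close> that is independent of \<open>X\<^sub>s\<close> involves the
  path at all times in [s, t]. It is approached by Riemann sums, first under bounded continuous test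
  functions and then, by truncation, under powers.\<close>

lemma continuous_on_integral_dominated:
  fixes f :: "'b::{metric_space} \<Rightarrow> 'a \<Rightarrow> 'c::{banach, second_countable_topology}"
  assumes cont: "\<And>x. x \<in> space M \<Longrightarrow> continuous_on S (\<lambda>z. f z x)"
    and [measurable]: "\<And>z. z \<in> S \<Longrightarrow> f z \<in> borel_measurable M"
    and bound: "\<And>z x. z \<in> S \<Longrightarrow> x \<in> space M \<Longrightarrow> norm (f z x) \<le> B x"
    and B: "integrable M B"
  shows "continuous_on S (\<lambda>z. \<integral>x. f z x \<partial>M)"
  unfolding continuous_on_sequentially comp_def
proof (intro allI ballI impI, elim conjE)
  fix Z z assume z: "z \<in> S" and Z: "\<forall>n. Z n \<in> S" "Z \<longlonglongrightarrow> z"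
  show "(\<lambda>n. \<integral>x. f (Z n) x \<partial>M) \<longlonglongrightarrow> (\<integral>x. f z x \<partial>M)"
  proof (rule integral_dominated_convergence)
    show "AE x in M. (\<lambda>n. f (Z n) x) \<longlonglongrightarrow> f z x"
    proof (rule AE_I2)
      fix x assume "x \<in> space M"
      from cont[OF this] z Z show "(\<lambda>n. f (Z n) x) \<longlonglongrightarrow> f z x"
        unfolding continuous_on_sequentially comp_def by blast
    qed
  qed (use Z z B bound in auto)
qed

text \<open>Cauchy's estimate makes the difference quotients of the integrand dominated as well.\<close>

lemma holomorphic_on_integral_dominated:
  fixes f :: "complex \<Rightarrow> 'a \<Rightarrow> complex"
  assumes S: "open S"
    and hol: "\<And>x. x \<in> space M \<Longrightarrow> (\<lambda>z. f z x) holomorphic_on S"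
    and [measurable]: "\<And>z. z \<in> S \<Longrightarrow> f z \<in> borel_measurable M"
    and bound: "\<And>z x. z \<in> S \<Longrightarrow> x \<in> space M \<Longrightarrow> norm (f z x) \<le> B x"
    and B: "integrable M B"
  shows "(\<lambda>z. \<integral>x. f z x \<partial>M) holomorphic_on S"
  unfolding holomorphic_on_open[OF S]
proof (intro ballI)
  fix w assume "w \<in> S"
  then obtain e where e: "e > 0" "cball w e \<subseteq> S"
    using S open_contains_cball by blast
  \<comment> \<open>Half the radius: a circle of radius r around any point of
    \<open>ball w r\<close> still lies in S, so Cauchy's estimate bounds the derivative by
    \<open>B x / r\<close> on the whole ball, not just at w.\<close>
  define r where "r = e / 2"
  have r: "r > 0" "\<And>\<zeta>. \<zeta> \<in> ball w r \<Longrightarrow> cball \<zeta> r \<subseteq> S"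
  proof -
    fix \<zeta> assume "\<zeta> \<in> ball w r"
    then have "cball \<zeta> r \<subseteq> cball w e"
    proof (intro subsetI)
      fix y assume "y \<in> cball \<zeta> r"
      with \<open>\<zeta> \<in> ball w r\<close> dist_triangle[of w y \<zeta>] show "y \<in> cball w e"
        by (simp add: r_def)
    qed
    then show "cball \<zeta> r \<subseteq> S" using e by auto
  qed (use e in \<open>simp add: r_def\<close>)
  have wr: "w \<in> ball w r" using r by simp
  have in_S: "\<zeta> \<in> S" if "\<zeta> \<in> ball w r" for \<zeta>
    using r(2)[OF that] r(1) by auto
  define D where "D x = deriv (\<lambda>z. f z x) w" for x
  have lip: "norm (f z x - f w x) \<le> B x / r * norm (z - w)" if x: "x \<in> space M" and z: "z \<in> ball w r" for x z
  proof (rule field_differentiable_bound[OF convex_ball _ _ z wr])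
    fix \<zeta> assume \<zeta>: "\<zeta> \<in> ball w r"
    show "((\<lambda>z. f z x) has_field_derivative deriv (\<lambda>z. f z x) \<zeta>) (at \<zeta> within ball w r)"
      using hol[OF x] S in_S[OF \<zeta>] holomorphic_derivI by blast
    have "norm ((deriv ^^ 1) (\<lambda>z. f z x) \<zeta>) \<le> fact 1 * B x / r ^ 1"
    proof (rule Cauchy_inequality)
      show "(\<lambda>z. f z x) holomorphic_on ball \<zeta> r"
        using hol[OF x] r(2)[OF \<zeta>] ball_subset_cball by (meson holomorphic_on_subset order_trans)
      show "continuous_on (cball \<zeta> r) (\<lambda>z. f z x)"
        using hol[OF x] r(2)[OF \<zeta>] by (meson holomorphic_on_subset holomorphic_on_imp_continuous_on)
      show "norm (f y x) \<le> B x" if "norm (\<zeta> - y) = r" for y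
        using that r(2)[OF \<zeta>] by (intro bound x) (auto simp: dist_norm)
    qed (use r in auto)
    then show "norm (deriv (\<lambda>z. f z x) \<zeta>) \<le> B x / r" by simp
  qed
  have int: "integrable M (f z)" if "z \<in> ball w r" for z
    using in_S[OF that] order_trans[OF bound abs_ge_self]
    by (intro Bochner_Integration.integrable_bound[OF B]) auto
  have "((\<lambda>z. ((\<integral>x. f z x \<partial>M) - (\<integral>x. f w x \<partial>M)) / (z - w)) \<longlongrightarrow> (\<integral>x. D x \<partial>M)) (at w within ball w r)"
    unfolding tendsto_at_iff_sequentially comp_def
  proof (intro allI impI)
    fix Z assume Z: "\<forall>i. Z i \<in> ball w r - {w}" "Z \<longlonglongrightarrow> w"
    have Zr: "Z i \<in> ball w r" "Z i \<noteq> w" for i using Z by auto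
    have lim: "(\<lambda>i. (f (Z i) x - f w x) / (Z i - w)) \<longlonglongrightarrow> D x" if x: "x \<in> space M" for x
    proof -
      have "((\<lambda>z. f z x) has_field_derivative D x) (at w)"
        unfolding D_def using hol[OF x] S \<open>w \<in> S\<close> holomorphic_derivI by blast
      then have "((\<lambda>z. (f z x - f w x) / (z - w)) \<longlongrightarrow> D x) (at w)"
        by (simp add: has_field_derivative_iff)
      with Z(2) Zr(2) show ?thesis
        unfolding tendsto_at_iff_sequentially comp_def by blast
    qed
    have [measurable]: "f (Z i) \<in> borel_measurable M" "f w \<in> borel_measurable M" for i
      using in_S[OF Zr(1)] \<open>w \<in> S\<close> by auto
    have "(\<lambda>i. \<integral>x. (f (Z i) x - f w x) / (Z i - w) \<partial>M) \<longlonglongrightarrow> (\<integral>x. D x \<partial>M)"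
    proof (rule integral_dominated_convergence)
      show "D \<in> borel_measurable M"
        by (rule borel_measurable_LIMSEQ_metric[OF _ lim]) simp_all
      show "integrable M (\<lambda>x. B x / r)" using B by simp
      show "AE x in M. (\<lambda>i. (f (Z i) x - f w x) / (Z i - w)) \<longlonglongrightarrow> D x"
        using lim by simp
      show "AE x in M. norm ((f (Z i) x - f w x) / (Z i - w)) \<le> B x / r" for i
        using lip[OF _ Zr(1)] Zr(2)[of i] by (auto simp: norm_divide divide_simps mult.commute)
    qed simp
    moreover have "(\<integral>x. (f (Z i) x - f w x) / (Z i - w) \<partial>M) =
        ((\<integral>x. f (Z i) x \<partial>M) - (\<integral>x. f w x \<partial>M)) / (Z i - w)" for i
      using int[OF Zr(1)] int[OF wr] by (simp add: Bochner_Integration.integral_diff)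
    ultimately show "(\<lambda>i. ((\<integral>x. f (Z i) x \<partial>M) - (\<integral>x. f w x \<partial>M)) / (Z i - w)) \<longlonglongrightarrow> (\<integral>x. D x \<partial>M)"
      by (simp only:)
  qed
  then show "\<exists>f'. ((\<lambda>z. \<integral>x. f z x \<partial>M) has_field_derivative f') (at w)"
    using at_within_open[OF wr open_ball] by (auto simp: has_field_derivative_iff)
qed

text \<open>A majorant integrable against the Levy measure and uniform in z. For \<bar>x\<bar> \<le>
  1 the second order Taylor remainder gives x^2 with the constant \<open>exp R * R\<^sup>2\<close>.
  For \<bar>x\<bar> > 1 the linear term costs \<open>R * \<bar>x\<bar>\<close>, the constants cost
  at most \<open>2 * \<bar>x\<bar>\<close>, and the exponential exceeds 1 only for x < -1, where Re
  z \<le> \<alpha> bounds it. The constant adds up both cases.\<close>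

lemma norm_compensated_exp_le:
  fixes z :: complex and x \<alpha> R :: real
  assumes z: "0 \<le> Re z" "Re z \<le> \<alpha>" "norm z \<le> R"
  shows "norm (exp (- z * of_real x) - 1 + z * of_real x) \<le>
    (exp R * R\<^sup>2 + R + 2) * min (x\<^sup>2) \<bar>x\<bar> + indicator {..<-1} x * exp (- \<alpha> * x)"
proof -
  have R: "0 \<le> R" using z(3) norm_ge_zero order_trans by blast
  have zx: "norm (z * of_real x) \<le> R * \<bar>x\<bar>"
    using z(3) by (simp add: norm_mult mult_right_mono)
  show ?thesis
  proof (cases "\<bar>x\<bar> \<le> 1")
    case True
    have "norm (exp (- z * of_real x) - (\<Sum>k\<le>1. (- z * of_real x) ^ k / fact k))
        \<le> exp \<bar>Re (- z * of_real x)\<bar> * norm (- z * of_real x) ^ Suc 1 / fact 1"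
      by (rule Taylor_exp)
    also have "\<dots> \<le> exp R * (R * \<bar>x\<bar>)\<^sup>2"
    proof -
      have "\<bar>Re (- z * of_real x)\<bar> \<le> norm (- z * of_real x)" by (rule abs_Re_le_cmod)
      also have "\<dots> \<le> R * \<bar>x\<bar>" using zx by simp
      also have "\<dots> \<le> R" using True R by (simp add: mult_left_le)
      finally show ?thesis using zx R
        by (auto intro!: mult_mono power_mono simp: numeral_2_eq_2[symmetric])
    qed
    also have "\<dots> = exp R * R\<^sup>2 * x\<^sup>2" by (simp add: power_mult_distrib)
    finally have 1: "norm (exp (- z * of_real x) - 1 + z * of_real x) \<le> exp R * R\<^sup>2 * x\<^sup>2"
      by (simp add: algebra_simps)
    have "x\<^sup>2 \<le> \<bar>x\<bar>" using True by (metis abs_ge_zero mult_left_le power2_abs power2_eq_square)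
    then have "min (x\<^sup>2) \<bar>x\<bar> = x\<^sup>2" by simp
    with R True have "exp R * R\<^sup>2 * x\<^sup>2 \<le> (exp R * R\<^sup>2 + R + 2) * min (x\<^sup>2) \<bar>x\<bar> + indicator {..<-1} x * exp (- \<alpha> * x)"
      by (simp add: algebra_simps)
    with 1 show ?thesis by linarith
  next
    case False
    then have "\<bar>x\<bar> * 1 \<le> \<bar>x\<bar> * \<bar>x\<bar>" by (intro mult_left_mono) auto
    then have m: "min (x\<^sup>2) \<bar>x\<bar> = \<bar>x\<bar>" by (simp add: power2_eq_square)
    have "norm (exp (- z * of_real x) - 1 + z * of_real x) \<le> norm (exp (- z * of_real x)) + 1 + R * \<bar>x\<bar>"
      using zx norm_triangle_ineq[of "exp (- z * of_real x) - 1" "z * of_real x"]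
        norm_triangle_ineq4[of "exp (- z * of_real x)" 1] by simp
    also have "norm (exp (- z * of_real x)) \<le> 1 + indicator {..<-1} x * exp (- \<alpha> * x)"
    proof (cases "x > 0")
      case True then show ?thesis using z by simp
    next
      case neg: False
      then have "- (Re z * x) \<le> - (\<alpha> * x)" using z by (simp add: mult_right_mono_neg)
      then show ?thesis using False neg by (simp add: add_increasing)
    qed
    also have "1 + indicator {..<-1} x * exp (- \<alpha> * x) + 1 + R * \<bar>x\<bar> \<le>
        (exp R * R\<^sup>2 + R + 2) * \<bar>x\<bar> + indicator {..<-1} x * exp (- \<alpha> * x)"
    proof -
      have "0 \<le> exp R * R\<^sup>2 * \<bar>x\<bar>" by simp
      moreover have "2 \<le> 2 * \<bar>x\<bar>" using False by simp
      ultimately show ?thesis by (simp only: distrib_right)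
    qed
    finally show ?thesis using m by simp
  qed
qed

text \<open>
  Both sides extend continuously to the strip \<open>0 \<le> Re z \<le> \<alpha>\<close>, holomorphically inside, and agree on
  the imaginary axis. Extended by 0 to the left, their difference is holomorphic across the axis.
\<close>

lemma exponential_moment_levy_khintchine:
  fixes \<mu> K :: "real measure" and b c t \<alpha> :: real
  assumes "real_distribution \<mu>" and sets_K: "sets K = sets borel"
    and K_int: "(\<integral>\<^sup>+x\<in>-{0}. ennreal (min (x\<^sup>2) \<bar>x\<bar>) \<partial>K) < \<infinity>"
    and tail: "(\<integral>\<^sup>+x\<in>{..<-1}. ennreal (exp (- \<alpha> * x)) \<partial>K) < \<infinity>"
    and \<alpha>: "\<alpha> > 0"
    and char: "\<And>u. char \<mu> u = exp (of_real t * (\<i> * of_real (u * b) - of_real (u\<^sup>2 * c / 2) +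
          (CLINT x:-{0}|K. iexp (u * x) - 1 - \<i> * of_real (u * x))))"
    and fin: "integrable \<mu> (\<lambda>x. exp (- \<alpha> * x))"
  shows "(\<integral>x. exp (- \<alpha> * x) \<partial>\<mu>) = exp (- t * laplace_exponent b c K \<alpha>)"
proof -
  interpret \<mu>: real_distribution \<mu> by fact
  note [measurable_cong] = sets_K \<mu>.events_eq_borel
  \<comment> \<open>The majorant needs a bounded region, so the strip is cut by a ball. Its radius
    exceeds \<alpha>, to keep the target point inside, and 1, to leave room to the left of the
    axis.\<close>
  define R where "R = \<alpha> + 1"
  define S where "S = {z. 0 \<le> Re z \<and> Re z \<le> \<alpha>} \<inter> ball 0 R"
  define F where "F z x = exp (- z * of_real x) - 1 + z * of_real x" for z :: complex and x :: real
  define L where "L z = (CLINT x|\<mu>. exp (- z * of_real x))" for z :: complex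
  define G where "G z = exp (of_real t * (- z * of_real b + z\<^sup>2 * of_real c / 2 + (CLINT x|K. F z x)))" for z
  define C where "C = exp R * R\<^sup>2 + R + 2"
  define B where "B x = C * min (x\<^sup>2) \<bar>x\<bar> + indicator {..<-1} x * exp (- \<alpha> * x)" for x :: real
  have R: "R > 1" using \<alpha> by (simp add: R_def)
  have C: "C \<ge> 0" using R by (simp add: C_def)
  have [measurable]: "F z \<in> borel_measurable borel" for z
    unfolding F_def by (intro borel_measurable_continuous_onI continuous_intros)
  have B_int: "integrable K B"
    unfolding B_def
  proof (intro Bochner_Integration.integrable_add integrable_mult_right)
    have "(\<integral>\<^sup>+x. norm (min (x\<^sup>2) \<bar>x\<bar>) \<partial>K) = (\<integral>\<^sup>+x\<in>-{0}. ennreal (min (x\<^sup>2) \<bar>x\<bar>) \<partial>K)"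
      by (intro nn_integral_cong) (auto simp: indicator_def)
    with K_int show "integrable K (\<lambda>x. min (x\<^sup>2) \<bar>x\<bar>)" by (intro integrableI_bounded) auto
    have "(\<integral>\<^sup>+x. norm (indicator {..<-1} x * exp (- \<alpha> * x)) \<partial>K) = (\<integral>\<^sup>+x\<in>{..<-1}. ennreal (exp (- \<alpha> * x)) \<partial>K)"
      by (intro nn_integral_cong) (auto simp: indicator_def)
    with tail show "integrable K (\<lambda>x. indicator {..<-1} x * exp (- \<alpha> * x))" by (intro integrableI_bounded) auto
  qed
  have F_bound: "norm (F z x) \<le> B x" if "z \<in> S" for z x
    unfolding F_def B_def C_def using that by (intro norm_compensated_exp_le) (auto simp: S_def)
  have L_bound: "norm (exp (- z * complex_of_real x)) \<le> 1 + exp (- \<alpha> * x)" if "z \<in> S" for z x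
  proof (cases "x \<ge> 0")
    case True then show ?thesis using that by (simp add: S_def add_increasing2)
  next
    case False then show ?thesis using that by (simp add: S_def mult_right_mono_neg add_increasing)
  qed
  have L_B: "integrable \<mu> (\<lambda>x. 1 + exp (- \<alpha> * x))" using fin by simp
  have meas_exp: "(\<lambda>x. exp (- z * complex_of_real x)) \<in> borel_measurable borel" for z
    by (intro borel_measurable_continuous_onI continuous_intros)
  have contK: "continuous_on S (\<lambda>z. CLINT x|K. F z x)"
    by (rule continuous_on_integral_dominated[OF _ _ F_bound B_int])
      (auto simp: F_def[abs_def] intro!: continuous_intros borel_measurable_continuous_onI)
  have contL: "continuous_on S L" unfolding L_def
    by (rule continuous_on_integral_dominated[OF _ _ L_bound L_B])
      (auto intro!: continuous_intros meas_exp)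
  have contG: "continuous_on S G" unfolding G_def by (intro continuous_intros contK) auto
  define S0 where "S0 = {z. 0 < Re z \<and> Re z < \<alpha>} \<inter> ball 0 R"
  have S0_eq: "S0 = {z. 0 < Re z} \<inter> {z. Re z < \<alpha>} \<inter> ball 0 R" by (auto simp: S0_def)
  have S0: "open S0" "S0 \<subseteq> S"
    unfolding S0_eq by (auto simp: S_def intro!: open_Int open_halfspace_Re_gt open_halfspace_Re_lt)
  have holK: "(\<lambda>z. CLINT x|K. F z x) holomorphic_on S0"
    by (rule holomorphic_on_integral_dominated[OF S0(1) _ _ _ B_int])
      (use S0(2) F_bound in \<open>auto simp: F_def[abs_def] intro!: holomorphic_intros borel_measurable_continuous_onI continuous_intros\<close>)
  have holL: "L holomorphic_on S0" unfolding L_def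
    by (rule holomorphic_on_integral_dominated[OF S0(1) _ _ _ L_B])
      (use S0(2) L_bound in \<open>auto intro!: holomorphic_intros meas_exp\<close>)
  have holG: "G holomorphic_on S0" unfolding G_def by (intro holomorphic_intros holK) auto
  have axis: "L z = G z" if "Re z = 0" for z
  proof -
    define v where "v = - Im z"
    have z: "z = - \<i> * of_real v"
      using that by (simp add: complex_eq_iff v_def)
    have "L z = char \<mu> v" by (simp add: L_def char_def z mult_ac)
    also have "\<dots> = exp (of_real t * (\<i> * of_real (v * b) - of_real (v\<^sup>2 * c / 2) +
          (CLINT x:-{0}|K. iexp (v * x) - 1 - \<i> * of_real (v * x))))" by (rule char)
    \<comment> \<open>\<open>F z 0 = 0\<close>, so restricting the integral to \<open>-{0}\<close>
      changes nothing.\<close>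
    also have "(CLINT x:-{0}|K. iexp (v * x) - 1 - \<i> * of_real (v * x)) = (CLINT x|K. F z x)"
      unfolding set_lebesgue_integral_def
      by (intro Bochner_Integration.integral_cong) (auto simp: F_def z indicator_def mult_ac)
    also have "\<i> * of_real (v * b) - of_real (v\<^sup>2 * c / 2) = - z * of_real b + z\<^sup>2 * of_real c / 2"
      by (simp add: z power_mult_distrib)
    finally show ?thesis by (simp add: G_def)
  qed
  define T where "T = {z. Re z < \<alpha>} \<inter> ball 0 R"
  define h where "h z = (if 0 \<le> Re z then L z - G z else 0)" for z
  have T: "open T" "connected T"
    unfolding T_def by (auto intro!: open_Int open_halfspace_Re_lt convex_connected convex_Int convex_halfspace_Re_lt)
  have conth: "continuous_on T h"
  proof -
    let ?A = "T \<inter> {z. 0 \<le> Re z}" and ?B = "T \<inter> {z. Re z \<le> 0}"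
    have "continuous_on (?A \<union> ?B) (\<lambda>z. if 0 \<le> Re z then L z - G z else 0)"
    proof (rule continuous_on_cases_local)
      have TT: "T = ?A \<union> ?B" by auto
      show "closedin (top_of_set (?A \<union> ?B)) ?A" "closedin (top_of_set (?A \<union> ?B)) ?B"
        unfolding TT[symmetric] by (auto intro!: closedin_closed_Int closed_halfspace_Re_ge closed_halfspace_Re_le)
      have "?A \<subseteq> S" by (auto simp: T_def S_def)
      then show "continuous_on ?A (\<lambda>z. L z - G z)"
        by (intro continuous_on_diff) (use contL contG continuous_on_subset in blast)+
    qed (auto simp: axis)
    moreover have "?A \<union> ?B = T" by auto
    ultimately show ?thesis by (simp add: h_def[abs_def])
  qed
  have "h holomorphic_on T"
  \<comment> \<open>The inner product with 1 is the real part, so the line of pasting is the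
    imaginary axis.\<close>
  proof (rule holomorphic_on_paste_across_line[where d=1 and k=0])
    have "h holomorphic_on {z. Re z < 0}"
      by (rule holomorphic_transform[of "\<lambda>_. 0"]) (auto simp: h_def)
    then show "h holomorphic_on T \<inter> {z. 1 \<bullet> z < 0}"
      by (rule holomorphic_on_subset) (auto simp: inner_complex_def)
    have "h holomorphic_on S0"
      by (rule holomorphic_transform[of "\<lambda>z. L z - G z"]) (auto simp: h_def S0_def intro!: holomorphic_on_diff holL[unfolded S0_def] holG[unfolded S0_def])
    then show "h holomorphic_on T \<inter> {z. 0 < 1 \<bullet> z}"
      by (rule holomorphic_on_subset) (auto simp: inner_complex_def T_def S0_def)
  qed (use T conth in auto)
  then have h0: "h w = 0" if "w \<in> T" for w
  proof (rule analytic_continuation[OF _ T])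
    let ?U = "T \<inter> {z. Re z < 0}"
    have U: "open ?U" using T by (auto intro!: open_Int open_halfspace_Re_lt)
    \<comment> \<open>Any point of T left of the axis would serve: h vanishes on a neighbourhood of
      it, hence on the connected set T.\<close>
    have half: "- 1/2 \<in> ?U" using \<alpha> R by (simp add: T_def norm_divide)
    show "?U \<subseteq> T" "- 1/2 \<in> T" using half by auto
    show "- 1/2 islimpt ?U" using half U by (metis interior_limit_point interior_open)
  qed (auto simp: h_def that)
  \<comment> \<open>The point \<alpha> lies on the boundary of T, out of reach of the identity
    theorem. It is approached along the real axis from inside, and continuity on the closed region S
    carries the equality over.\<close>
  define w where "w n = complex_of_real (\<alpha> - \<alpha> / (real n + 1))" for n
  have w_lim: "w \<longlonglongrightarrow> complex_of_real \<alpha>"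
  proof -
    have "(\<lambda>n. \<alpha> / real (Suc n)) \<longlonglongrightarrow> 0"
      by (rule LIMSEQ_Suc) (rule lim_const_over_n)
    from tendsto_diff[OF tendsto_const[of \<alpha>] this] have "(\<lambda>n. \<alpha> - \<alpha> / (real n + 1)) \<longlonglongrightarrow> \<alpha>"
      by (simp add: add.commute)
    then show ?thesis unfolding w_def by (rule tendsto_of_real)
  qed
  have wr: "0 \<le> \<alpha> - \<alpha> / (real n + 1)" "\<alpha> - \<alpha> / (real n + 1) < \<alpha>" for n
    using \<alpha> by (auto simp: field_simps)
  have wS: "w n \<in> S" "w n \<in> T" "complex_of_real \<alpha> \<in> S" for n
    using wr[of n] less_le_trans[of "-1" 0 "\<alpha> / (real n + 1)"] \<alpha>
    by (auto simp: w_def S_def T_def R_def simp del: of_real_diff of_real_divide)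
  have "L (w n) - G (w n) = 0" for n
    using h0[OF wS(2)] wr(1) by (simp add: h_def w_def del: of_real_diff of_real_divide)
  moreover have "(\<lambda>n. L (w n) - G (w n)) \<longlonglongrightarrow> L \<alpha> - G \<alpha>"
    using contL contG wS w_lim
    by (intro tendsto_diff) (auto simp: continuous_on_sequentially comp_def)
  ultimately have "L \<alpha> = G \<alpha>" using LIMSEQ_const_iff[of 0 "L \<alpha> - G \<alpha>"] by simp
  moreover have "L \<alpha> = complex_of_real (\<integral>x. exp (- \<alpha> * x) \<partial>\<mu>)"
    unfolding L_def integral_complex_of_real[symmetric]
    by (intro Bochner_Integration.integral_cong) (auto simp flip: exp_of_real)
  moreover have "(CLINT x|K. F \<alpha> x) = complex_of_real (LINT x:-{0}|K. exp (- \<alpha> * x) - 1 + \<alpha> * x)"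
    unfolding set_lebesgue_integral_def integral_complex_of_real[symmetric]
    by (intro Bochner_Integration.integral_cong) (auto simp: F_def indicator_def simp flip: exp_of_real)
  then have "G \<alpha> = complex_of_real (exp (- t * laplace_exponent b c K \<alpha>))"
    unfolding G_def laplace_exponent_def
    by (simp flip: exp_of_real) (simp add: algebra_simps)
  ultimately show ?thesis using of_real_eq_iff by metis
qed

section \<open>Path integrals\<close>

text \<open>Boundedness holds near each point by the one-sided limits and passes to unions of
  adjacent intervals, so bisection gives it on {0..T}. The guard s \<ge> 0 inside P is there because
  nothing is known about f at negative times, which neighbourhoods of 0 contain.\<close>

lemma cadlag_bounded:
  fixes f :: "real \<Rightarrow> real"
  assumes right: "\<And>t. t \<ge> 0 \<Longrightarrow> continuous (at_right t) f"
    and left: "\<And>t. t > 0 \<Longrightarrow> \<exists>l. (f \<longlongrightarrow> l) (at_left t)"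
    and "T \<ge> 0"
  obtains C where "\<And>s. 0 \<le> s \<Longrightarrow> s \<le> T \<Longrightarrow> \<bar>f s\<bar> \<le> C"
proof -
  have ev: "\<forall>\<^sub>F s in F. \<bar>f s\<bar> \<le> \<bar>l\<bar> + 1" if "(f \<longlongrightarrow> l) F" for l :: real and F
  proof -
    have "((\<lambda>s. \<bar>f s\<bar>) \<longlongrightarrow> \<bar>l\<bar>) F" using that by (rule tendsto_rabs)
    then have "\<forall>\<^sub>F s in F. \<bar>f s\<bar> < \<bar>l\<bar> + 1" by (rule order_tendstoD) simp
    then show ?thesis by eventually_elim simp
  qed
  define P where "P a b \<longleftrightarrow> (\<exists>C. \<forall>s. a \<le> s \<and> s \<le> b \<longrightarrow> s \<ge> 0 \<longrightarrow> \<bar>f s\<bar> \<le> C)" for a b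
  have "P 0 T"
    using \<open>T \<ge> 0\<close>
  proof (induction rule: Bolzano)
    case (trans a b c)
    then obtain C1 C2 where C: "\<forall>s. a \<le> s \<and> s \<le> b \<longrightarrow> s \<ge> 0 \<longrightarrow> \<bar>f s\<bar> \<le> C1"
      "\<forall>s. b \<le> s \<and> s \<le> c \<longrightarrow> s \<ge> 0 \<longrightarrow> \<bar>f s\<bar> \<le> C2" unfolding P_def by blast
    have "\<bar>f s\<bar> \<le> max C1 C2" if "a \<le> s" "s \<le> c" "s \<ge> 0" for s
      unfolding le_max_iff_disj using that C[rule_format, of s] by (cases "s \<le> b") auto
    then show ?case unfolding P_def by blast
  next
    case (local x)
    have "(f \<longlongrightarrow> f x) (at_right x)" using right[OF local(1)] by (simp add: continuous_within)
    from ev[OF this] obtain d1 where d1: "d1 > x" "\<And>s. x < s \<Longrightarrow> s < d1 \<Longrightarrow> \<bar>f s\<bar> \<le> \<bar>f x\<bar> + 1"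
      by (auto simp: eventually_at_right_field)
    obtain d2 C where d2: "d2 < x" "\<And>s. d2 < s \<Longrightarrow> s < x \<Longrightarrow> s \<ge> 0 \<Longrightarrow> \<bar>f s\<bar> \<le> C"
    proof (cases "x = 0")
      \<comment> \<open>At 0 no left limit exists; the guard s \<ge> 0 makes the condition on points
        left of 0 empty, so any negative number works.\<close>
      case True then show ?thesis by (intro that[of "-1"]) auto
    next
      case False
      with local have "x > 0" by simp
      from left[OF this] obtain l where "(f \<longlongrightarrow> l) (at_left x)" by blast
      from ev[OF this] obtain d where "d < x" "\<And>s. d < s \<Longrightarrow> s < x \<Longrightarrow> \<bar>f s\<bar> \<le> \<bar>l\<bar> + 1"
        by (auto simp: eventually_at_left_field)
      then show ?thesis by (rule that)
    qed
    have "\<exists>C. \<forall>s. a \<le> s \<and> s \<le> b \<longrightarrow> s \<ge> 0 \<longrightarrow> \<bar>f s\<bar> \<le> C"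
      if "a \<le> x" "x \<le> b" "b - a < min (d1 - x) (x - d2)" for a b
    proof (intro exI[of _ "max (\<bar>f x\<bar> + 1) C"] allI impI)
      fix s assume "a \<le> s \<and> s \<le> b" "s \<ge> 0"
      with that have s: "d2 < s" "s < d1" "s \<ge> 0" by auto
      show "\<bar>f s\<bar> \<le> max (\<bar>f x\<bar> + 1) C"
        unfolding le_max_iff_disj using d1(2)[of s] d2(2)[of s] s
        by (cases s x rule: linorder_cases) auto
    qed
    moreover have "min (d1 - x) (x - d2) > 0" using d1(1) d2(1) by simp
    ultimately show ?case unfolding P_def by blast
  qed
  then show ?thesis using that unfolding P_def by blast
qed

text \<open>Sampling at right end points approaches every u from the right, so right-continuity
  suffices for pointwise convergence of the step functions; the bound C dominates them.\<close>

lemma riemann_sum_right_continuous: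
  fixes g :: "real \<Rightarrow> real"
  assumes [measurable]: "g \<in> borel_measurable borel" and "r > 0"
    and cont: "\<And>u. u \<ge> 0 \<Longrightarrow> continuous (at_right u) g"
    and bound: "\<And>u. 0 \<le> u \<Longrightarrow> u \<le> r \<Longrightarrow> \<bar>g u\<bar> \<le> C"
  shows "(\<lambda>n. r / real (Suc n) * (\<Sum>k=1..Suc n. g (r * real k / real (Suc n))))
    \<longlonglongrightarrow> (LINT u:{0<..r}|lborel. g u)"
proof -
  define p where "p n k = r * real k / real (Suc n)" for n k :: nat
  define step where "step n u = (\<Sum>k=1..Suc n. indicator {p n (k-1)<..p n k} u * g (p n k))" for n u
  \<comment> \<open>The index of the cell that contains u. Cells are open on the left and closed on
    the right, hence the ceiling.\<close>
  define \<kappa> where "\<kappa> n u = nat \<lceil>u * real (Suc n) / r\<rceil>" for n :: nat and u :: real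
  have \<kappa>: "\<kappa> n u \<in> {1..Suc n}" "u \<le> p n (\<kappa> n u)" "p n (\<kappa> n u) \<le> u + r / real (Suc n)" "p n (\<kappa> n u) \<le> r"
    "p n (\<kappa> n u - 1) < u"
    if u: "0 < u" "u \<le> r" for n u
  proof -
    define y where "y = u * real (Suc n) / r"
    have "u * real (Suc n) \<le> r * real (Suc n)" using u by (intro mult_right_mono) auto
    then have y: "0 < y" "y \<le> real (Suc n)"
      using u \<open>r > 0\<close> by (auto simp: y_def divide_le_eq mult.commute simp del: of_nat_Suc)
    have uy: "u = r * y / real (Suc n)" using \<open>r > 0\<close> by (simp add: y_def)
    have k: "real (\<kappa> n u) = of_int \<lceil>y\<rceil>" "\<kappa> n u = nat \<lceil>y\<rceil>" using y unfolding \<kappa>_def y_def[symmetric] by simp_all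
    have c: "1 \<le> \<lceil>y\<rceil>" "\<lceil>y\<rceil> \<le> int (Suc n)" using y by (auto simp: ceiling_le_iff)
    show mem: "\<kappa> n u \<in> {1..Suc n}" unfolding k(2) using c by (simp add: nat_le_iff le_nat_iff)
    have le: "y \<le> real (\<kappa> n u)" "real (\<kappa> n u) < y + 1" "real (\<kappa> n u) \<le> real (Suc n)"
      using k c by linarith+
    have mono: "r * a / real (Suc n) \<le> r * b / real (Suc n)" if "a \<le> b" for a b
      using that \<open>r > 0\<close> by (intro divide_right_mono mult_left_mono) auto
    show "u \<le> p n (\<kappa> n u)" unfolding p_def using mono[OF le(1)] uy by simp
    show "p n (\<kappa> n u) \<le> u + r / real (Suc n)"
      using mono[OF less_imp_le[OF le(2)]] uy by (simp add: p_def distrib_left add_divide_distrib)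
    show "p n (\<kappa> n u) \<le> r" using mono[OF le(3)] by (simp add: p_def)
    show "p n (\<kappa> n u - 1) < u"
      using le(2) mem \<open>r > 0\<close> unfolding p_def by (subst uy) (auto intro!: divide_strict_right_mono mult_strict_left_mono)
  qed
  have step_eq: "step n u = g (p n (\<kappa> n u))" if u: "0 < u" "u \<le> r" for n u
  proof -
    have "indicator {p n (k-1)<..p n k} u = (if k = \<kappa> n u then 1 else 0 :: real)" if "k \<in> {1..Suc n}" for k
    proof -
      have mono: "p n a \<le> p n b" if "a \<le> b" for a b
        using that \<open>r > 0\<close> by (auto simp: p_def intro!: divide_right_mono)
      show ?thesis
      proof (cases k "\<kappa> n u" rule: linorder_cases)
        case less
        then have "k \<le> \<kappa> n u - 1" by simp
        then have "p n k < u" using \<kappa>(5)[OF u, of n] mono[of k "\<kappa> n u - 1"] by linarith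
        then show ?thesis using less by (auto simp: indicator_def)
      next
        case greater
        then have "\<kappa> n u \<le> k - 1" by simp
        then have "u \<le> p n (k - 1)" using \<kappa>(2)[OF u, of n] mono[of "\<kappa> n u" "k - 1"] by linarith
        then show ?thesis using greater by (auto simp: indicator_def)
      qed (use \<kappa>[OF u, of n] in \<open>auto simp: indicator_def\<close>)
    qed
    then have "step n u = (\<Sum>k=1..Suc n. (if k = \<kappa> n u then 1 else 0) * g (p n k))"
      unfolding step_def by (intro sum.cong) auto
    also have "\<dots> = (\<Sum>k=1..Suc n. if k = \<kappa> n u then g (p n k) else 0)" by (intro sum.cong) auto
    also have "\<dots> = g (p n (\<kappa> n u))" using \<kappa>(1)[OF u, of n] by (subst sum.delta) auto
    finally show ?thesis .
  qed
  have step_lim: "(\<lambda>n. step n u) \<longlonglongrightarrow> g u" if u: "0 < u" "u \<le> r" for u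
  proof -
    have "(\<lambda>n. p n (\<kappa> n u)) \<longlonglongrightarrow> u"
    proof (rule tendsto_sandwich[of "\<lambda>_. u"])
      have "(\<lambda>n. r / real (Suc n)) \<longlonglongrightarrow> 0" by (rule LIMSEQ_Suc) (rule lim_const_over_n)
      from tendsto_add[OF tendsto_const[of u] this] show "(\<lambda>n. u + r / real (Suc n)) \<longlonglongrightarrow> u" by simp
    qed (use \<kappa>[OF u] in auto)
    moreover have "continuous (at u within {u..}) g" using cont[of u] u by (simp add: at_within_Ici_at_right)
    ultimately show ?thesis
      using \<kappa>(2)[OF u] by (simp add: continuous_within_sequentially comp_def step_eq[OF u])
  qed
  have step_zero: "step n u = 0" if "\<not> (0 < u \<and> u \<le> r)" for n u
  proof -
    have "0 \<le> p n (k-1)" "p n k \<le> r" if "k \<in> {1..Suc n}" for k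
      using that \<open>r > 0\<close> by (auto simp: p_def divide_le_eq)
    then have "u \<notin> {p n (k-1)<..p n k}" if "k \<in> {1..Suc n}" for k
      using that \<open>\<not> (0 < u \<and> u \<le> r)\<close> by force
    then show ?thesis unfolding step_def by (intro sum.neutral ballI) simp
  qed
  have [measurable]: "step n \<in> borel_measurable borel" for n
    unfolding step_def by measurable
  have "(\<lambda>n. \<integral>u. step n u \<partial>lborel) \<longlonglongrightarrow> (\<integral>u. indicator {0<..r} u *\<^sub>R g u \<partial>lborel)"
  proof (rule integral_dominated_convergence)
    show "integrable lborel (\<lambda>u. indicator {0<..r} u * C)" using \<open>r > 0\<close> by simp
    show "AE u in lborel. (\<lambda>n. step n u) \<longlonglongrightarrow> indicator {0<..r} u *\<^sub>R g u"
      using step_lim step_zero by (auto intro!: AE_I2 simp: indicator_def)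
    show "AE u in lborel. norm (step n u) \<le> indicator {0<..r} u * C" for n
    proof (rule AE_I2)
      fix u show "norm (step n u) \<le> indicator {0<..r} u * C"
      proof (cases "0 < u \<and> u \<le> r")
        case True
        then show ?thesis using bound[of "p n (\<kappa> n u)"] \<kappa>[of u n] step_eq[of u n] by simp
      qed (simp add: step_zero)
    qed
  qed simp_all
  moreover have "(\<integral>u. step n u \<partial>lborel) = r / real (Suc n) * (\<Sum>k=1..Suc n. g (p n k))" for n
  proof -
    have len: "measure lborel {p n (k-1)<..p n k} = r / real (Suc n)" if "k \<in> {1..Suc n}" for k
    proof -
      have "p n k - p n (k - 1) = r / real (Suc n)"
        using that by (simp add: p_def diff_divide_distrib[symmetric] right_diff_distrib[symmetric])
      moreover have "r / real (Suc n) \<ge> 0" using \<open>r > 0\<close> by simp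
      ultimately show ?thesis by simp
    qed
    have "(\<integral>u. step n u \<partial>lborel) = (\<Sum>k=1..Suc n. (\<integral>u. indicator {p n (k-1)<..p n k} u * g (p n k) \<partial>lborel))"
      unfolding step_def
    proof (rule Bochner_Integration.integral_sum)
      fix k
      have "p n (k-1) \<le> p n k" using \<open>r > 0\<close> by (auto simp: p_def intro!: divide_right_mono)
      then show "integrable lborel (\<lambda>u. indicator {p n (k-1)<..p n k} u * g (p n k))" by simp
    qed
    also have "\<dots> = (\<Sum>k=1..Suc n. r / real (Suc n) * g (p n k))"
      using len by (intro sum.cong) auto
    finally show ?thesis by (simp only: sum_distrib_left)
  qed
  ultimately show ?thesis by (simp add: p_def set_lebesgue_integral_def)
qed

text \<open>The counterpart of \<open>ennreal_powr\<close> on finite values. With 0^0 = 1 the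
  derivative of \<open>y powr a\<close> is written \<open>a * pow_real (a - 1) y\<close> also for a
  = 1, with the right value at y = 0.\<close>

definition pow_real :: "real \<Rightarrow> real \<Rightarrow> real" where
  "pow_real a y = (if a = 0 then 1 else y powr a)"

text \<open>For a \<ge> 1 the derivative is increasing, so in the mean value theorem its value lies
  between those at the two ends. The case y = 0 is separate because differentiating
  \<open>powr\<close> requires a positive base.\<close>

lemma powr_diff_bounds:
  fixes x y a :: real
  assumes "0 \<le> y" "y \<le> x" "1 \<le> a"
  shows "a * pow_real (a - 1) y * (x - y) \<le> x powr a - y powr a"
    and "x powr a - y powr a \<le> a * pow_real (a - 1) x * (x - y)"
proof -
  have "a * pow_real (a - 1) y * (x - y) \<le> x powr a - y powr a \<and>
    x powr a - y powr a \<le> a * pow_real (a - 1) x * (x - y)"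
  proof (cases "y = 0 \<or> y = x")
    case True
    then consider "y = x" | "y = 0" "x > 0" using assms by fastforce
    then show ?thesis
    proof cases
      case 2
      have x: "pow_real (a - 1) x = x powr (a - 1)" "x powr a = x powr (a - 1) * x"
        using 2 by (simp_all add: pow_real_def powr_diff)
      have "1 * (x powr (a - 1) * x) \<le> a * (x powr (a - 1) * x)"
        using 2 assms by (intro mult_right_mono) auto
      then have "x powr a - y powr a \<le> a * pow_real (a - 1) x * (x - y)"
        using 2 by (simp add: x)
      moreover have "a * pow_real (a - 1) y * (x - y) \<le> x powr a - y powr a"
        using 2 by (cases "a = 1") (simp_all add: pow_real_def)
      ultimately show ?thesis by simp
    qed simp
  next
    case False
    then have y: "0 < y" "y < x" using assms by auto
    have "\<exists>z. y < z \<and> z < x \<and> x powr a - y powr a = (x - y) * (a * z powr (a - 1))"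
      using y by (intro MVT2) (auto intro!: derivative_eq_intros)
    then obtain z where z: "y < z" "z < x" "x powr a - y powr a = (x - y) * (a * z powr (a - 1))" by blast
    have "pow_real (a - 1) y \<le> z powr (a - 1)" "z powr (a - 1) \<le> pow_real (a - 1) x"
      using z y assms by (auto simp: pow_real_def intro!: powr_mono2)
    then have "a * pow_real (a - 1) y * (x - y) \<le> a * z powr (a - 1) * (x - y)"
      "a * z powr (a - 1) * (x - y) \<le> a * pow_real (a - 1) x * (x - y)"
      using y assms by (auto intro!: mult_right_mono mult_left_mono)
    then show ?thesis unfolding z(3) by (simp add: mult.commute)
  qed
  then show "a * pow_real (a - 1) y * (x - y) \<le> x powr a - y powr a"
    "x powr a - y powr a \<le> a * pow_real (a - 1) x * (x - y)" by auto
qed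

text \<open>
  \<open>J\<close> need not be differentiable, but the difference \<open>D\<close> of the two sides, as functions of the
  lower limit, satisfies \<open>\<bar>D s' - D s\<bar> \<le> a C \<bar>Q s' - Q s\<bar> \<bar>s' - s\<bar>\<close> with \<open>Q\<close> continuous, so \<open>D' = 0\<close>.
\<close>

lemma powr_integral_eq:
  fixes g :: "real \<Rightarrow> real"
  assumes g_int: "integrable lborel g" and g: "\<And>u. 0 \<le> g u" "\<And>u. g u \<le> C" "\<forall>u>T. g u = 0"
    and a: "a \<ge> 1"
  defines "J \<equiv> \<lambda>s. \<integral>u. indicator {s..} u * g u \<partial>lborel"
  shows "J s powr a = a * (\<integral>u. indicator {s..} u * (pow_real (a - 1) (J u) * g u) \<partial>lborel)"
    and "integrable lborel (\<lambda>u. pow_real (a - 1) (J u) * g u)"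
proof -
  define Q where "Q u = pow_real (a - 1) (J u)" for u
  define W where "W s = (\<integral>u. indicator {s..} u * (Q u * g u) \<partial>lborel)" for s
  define D where "D s = J s powr a - a * W s" for s
  have [measurable]: "g \<in> borel_measurable borel" using borel_measurable_integrable[OF g_int] by simp
  have diff: "(\<integral>u. indicator {s..} u * f u \<partial>lborel) - (\<integral>u. indicator {s'..} u * f u \<partial>lborel) =
      (\<integral>u. indicator {s..<s'} u * f u \<partial>lborel)" "integrable lborel (\<lambda>u. indicator {s..<s'} u * f u)"
    if f: "integrable lborel f" and "s \<le> s'" for f :: "real \<Rightarrow> real" and s s'
  proof -
    have i: "integrable lborel (\<lambda>u. indicator A u * f u)" if "A \<in> sets borel" for A
      using integrable_mult_indicator[OF _ f, of A] that by simp
    show "integrable lborel (\<lambda>u. indicator {s..<s'} u * f u)" by (rule i) simp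
    show "(\<integral>u. indicator {s..} u * f u \<partial>lborel) - (\<integral>u. indicator {s'..} u * f u \<partial>lborel) =
      (\<integral>u. indicator {s..<s'} u * f u \<partial>lborel)"
      by (subst Bochner_Integration.integral_diff[OF i i, symmetric])
        (use \<open>s \<le> s'\<close> in \<open>auto intro!: Bochner_Integration.integral_cong simp: indicator_def\<close>)
  qed
  have J0: "0 \<le> J s" for s unfolding J_def using g by (intro integral_nonneg_AE) auto
  have J_diff: "0 \<le> J s - J s'" "J s - J s' \<le> C * (s' - s)" if "s \<le> s'" for s s'
  proof -
    note d = diff[OF g_int that]
    show "0 \<le> J s - J s'" unfolding J_def d(1) using g by (intro integral_nonneg_AE) auto
    have "J s - J s' \<le> (\<integral>u. indicator {s..<s'} u * C \<partial>lborel)" unfolding J_def d(1)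
    proof (rule integral_mono[OF d(2)])
      show "integrable lborel (\<lambda>u. indicator {s..<s'} u * C)" using that by simp
    qed (use g in \<open>auto simp: indicator_def\<close>)
    also have "\<dots> = C * (s' - s)" using that by simp
    finally show "J s - J s' \<le> C * (s' - s)" .
  qed
  have C: "C \<ge> 0" using g order_trans by blast
  have Q0: "0 \<le> Q s" for s by (simp add: Q_def pow_real_def)
  have Q_mono: "Q s' \<le> Q s" if "s \<le> s'" for s s'
    using J_diff[OF that] J0[of s'] a by (auto simp: Q_def pow_real_def intro!: powr_mono2)
  have J_cont: "isCont J s" for s
  proof -
    have "\<bar>J s' - J s\<bar> \<le> C * \<bar>s' - s\<bar>" for s'
      using J_diff[of s s'] J_diff[of s' s] by (cases "s \<le> s'") auto
    then have "\<forall>\<^sub>F s' in at s. norm (J s' - J s) \<le> C * \<bar>s' - s\<bar>" by simp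
    moreover have "((\<lambda>s'. C * \<bar>s' - s\<bar>) \<longlongrightarrow> 0) (at s)" by (auto intro!: tendsto_eq_intros)
    ultimately have "((\<lambda>s'. J s' - J s) \<longlongrightarrow> 0) (at s)" by (rule Lim_null_comparison)
    then show ?thesis unfolding isCont_def by (rule LIM_zero_cancel)
  qed
  \<comment> \<open>For a = 1 the function Q is constantly 1, whereas \<open>J s powr 0\<close>
    would jump where J reaches 0.\<close>
  have Q_cont: "isCont Q s" for s
  proof (cases "a = 1")
    case False
    then have "isCont (\<lambda>s. J s powr (a - 1)) s" unfolding isCont_def
      using a J0 J_cont[of s] by (intro tendsto_powr') (auto simp: isCont_def)
    then show ?thesis using False by (simp add: Q_def[abs_def] pow_real_def)
  qed (simp add: Q_def[abs_def] pow_real_def)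
  have [measurable]: "Q \<in> borel_measurable borel"
    using Q_cont by (intro borel_measurable_continuous_onI continuous_at_imp_continuous_on) auto
  have Q_bound: "Q s \<le> pow_real (a - 1) (integral\<^sup>L lborel g)" for s
  proof -
    have "J s \<le> integral\<^sup>L lborel g" unfolding J_def
      using g integrable_mult_indicator[OF _ g_int, of "{s..}"] g_int by (intro integral_mono) (auto simp: indicator_def)
    then show ?thesis using a J0[of s] by (auto simp: Q_def pow_real_def intro!: powr_mono2)
  qed
  show Qg: "integrable lborel (\<lambda>u. pow_real (a - 1) (J u) * g u)"
    unfolding Q_def[symmetric]
  proof (rule Bochner_Integration.integrable_bound)
    show "integrable lborel (\<lambda>u. pow_real (a - 1) (integral\<^sup>L lborel g) * g u)" using g_int by simp
    have "norm (Q u * g u) \<le> norm (pow_real (a - 1) (integral\<^sup>L lborel g) * g u)" for u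
      using mult_right_mono[OF Q_bound g(1)[of u]] Q0[of u] g(1)[of u] by (simp add: abs_mult pow_real_def)
    then show "AE u in lborel. norm (Q u * g u) \<le> norm (pow_real (a - 1) (integral\<^sup>L lborel g) * g u)" by simp
  qed simp
  \<comment> \<open>Q is decreasing, so on {s..<s'} it lies between \<open>Q s'\<close> and
    \<open>Q s\<close>.\<close>
  have W_diff: "Q s' * (J s - J s') \<le> W s - W s'" "W s - W s' \<le> Q s * (J s - J s')" if "s \<le> s'" for s s'
  proof -
    note d = diff[OF g_int that] and e = diff[OF Qg[folded Q_def] that]
    have "Q s' * (J s - J s') = (\<integral>u. Q s' * (indicator {s..<s'} u * g u) \<partial>lborel)"
      unfolding J_def d(1) by simp
    also have "\<dots> \<le> W s - W s'" unfolding W_def e(1)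
      using g Q_mono by (intro integral_mono e(2) integrable_mult_right d(2)) (auto simp: indicator_def intro!: mult_right_mono)
    finally show "Q s' * (J s - J s') \<le> W s - W s'" .
    have "W s - W s' \<le> (\<integral>u. Q s * (indicator {s..<s'} u * g u) \<partial>lborel)" unfolding W_def e(1)
      using g Q_mono by (intro integral_mono e(2) integrable_mult_right d(2)) (auto simp: indicator_def intro!: mult_right_mono)
    also have "\<dots> = Q s * (J s - J s')" unfolding J_def d(1) by simp
    finally show "W s - W s' \<le> Q s * (J s - J s')" .
  qed
  have D_diff: "\<bar>D s' - D s\<bar> \<le> a * C * \<bar>Q s' - Q s\<bar> * \<bar>s' - s\<bar>" for s s'
  proof -
    \<comment> \<open>The increments of \<open>J powr a\<close> and of \<open>a * W\<close> lie in
      one and the same interval, with ends \<open>a * Q s' * (J s - J s')\<close> and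
      \<open>a * Q s * (J s - J s')\<close>. Their difference is at most its length.\<close>
    have *: "\<bar>D s' - D s\<bar> \<le> a * C * \<bar>Q s' - Q s\<bar> * \<bar>s' - s\<bar>" if "s \<le> s'" for s s'
    proof -
      have p: "a * (Q s' * (J s - J s')) \<le> J s powr a - J s' powr a"
        "J s powr a - J s' powr a \<le> a * (Q s * (J s - J s'))"
        using powr_diff_bounds[of "J s'" "J s" a] J0 J_diff[OF that] a by (auto simp: Q_def mult.assoc)
      have w: "a * (Q s' * (J s - J s')) \<le> a * (W s - W s')" "a * (W s - W s') \<le> a * (Q s * (J s - J s'))"
        using W_diff[OF that] a by (auto intro!: mult_left_mono)
      have "\<bar>D s' - D s\<bar> \<le> a * (Q s * (J s - J s')) - a * (Q s' * (J s - J s'))"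
        using p w unfolding D_def right_diff_distrib by linarith
      also have "\<dots> = a * (Q s - Q s') * (J s - J s')" by (simp add: algebra_simps)
      also have "\<dots> \<le> a * (Q s - Q s') * (C * (s' - s))"
        using J_diff[OF that] Q_mono[OF that] a by (intro mult_left_mono) auto
      finally show ?thesis using Q_mono[OF that] that by (simp add: mult_ac abs_of_nonpos)
    qed
    show ?thesis using *[of s s'] *[of s' s] by (cases "s \<le> s'") (auto simp: abs_minus_commute)
  qed
  have "(D has_real_derivative 0) (at s)" for s
    unfolding has_field_derivative_iff
  proof (rule Lim_null_comparison)
    show "((\<lambda>s'. a * C * \<bar>Q s' - Q s\<bar>) \<longlongrightarrow> 0) (at s)"
      using Q_cont[of s] by (auto intro!: tendsto_eq_intros simp: isCont_def)
    have "norm ((D s' - D s) / (s' - s)) \<le> a * C * \<bar>Q s' - Q s\<bar>" if "s' \<noteq> s" for s'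
      using D_diff[of s' s] that by (simp add: divide_le_eq)
    then show "\<forall>\<^sub>F s' in at s. norm ((D s' - D s) / (s' - s)) \<le> a * C * \<bar>Q s' - Q s\<bar>"
      by (auto simp: eventually_at_filter)
  qed
  \<comment> \<open>Beyond T the integrand is zero, so the constant value of D can be read off at T
    + 1.\<close>
  then have "D s = D (T + 1)" by (intro DERIV_isconst_all) auto
  also have "\<dots> = 0"
  proof -
    have "J (T + 1) = 0" "W (T + 1) = 0"
      unfolding J_def W_def using g(3) by (auto intro!: integral_eq_zero_AE AE_I2 simp: indicator_def)
    then show ?thesis using a by (simp add: D_def)
  qed
  finally show "J s powr a = a * (\<integral>u. indicator {s..} u * (pow_real (a - 1) (J u) * g u) \<partial>lborel)"
    by (simp add: D_def W_def Q_def)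
qed


lemma ennreal_powr_ennreal: "y \<ge> 0 \<Longrightarrow> ennreal_powr (ennreal y) a = ennreal (pow_real a y)"
  by (simp add: ennreal_powr_def pow_real_def)

text \<open>\<open>powr_integral_eq\<close> carried over to [0, \<infinity>]. Cutting g off outside
  {0..t} makes it bounded and integrable, and for s \<ge> 0 the tails of the cut function over {s..}
  are the integrals of g over {s..t}.\<close>

lemma ennreal_powr_nn_integral_eq:
  fixes g :: "real \<Rightarrow> real"
  assumes [measurable]: "g \<in> borel_measurable borel" and g: "\<And>u. 0 \<le> g u" "\<And>u. 0 \<le> u \<Longrightarrow> u \<le> t \<Longrightarrow> g u \<le> C"
    and a: "a \<ge> 1"
  shows "ennreal_powr (\<integral>\<^sup>+u\<in>{0..t}. ennreal (g u) \<partial>lborel) a =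
    ennreal a * (\<integral>\<^sup>+s\<in>{0..t}. ennreal_powr (\<integral>\<^sup>+u\<in>{s..t}. ennreal (g u) \<partial>lborel) (a - 1) * ennreal (g s) \<partial>lborel)"
proof -
  define h where "h u = indicator {0..t} u * g u" for u
  define J where "J s = (\<integral>u. indicator {s..} u * h u \<partial>lborel)" for s
  \<comment> \<open>For t < 0 the bound on g is vacuous and C may be negative; the absolute value
    still dominates h, which is then zero.\<close>
  have h: "0 \<le> h u" "h u \<le> \<bar>C\<bar>" "\<forall>u>t. h u = 0" for u
    using g(1)[of u] g(2)[of u] by (auto simp: h_def indicator_def)
  have h_int: "integrable lborel h"
  proof (rule Bochner_Integration.integrable_bound)
    show "integrable lborel (\<lambda>u. indicator {0..t} u * C)" by (cases "0 \<le> t") auto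
    show "AE u in lborel. norm (h u) \<le> norm (indicator {0..t} u * C)"
      using g by (auto simp: h_def indicator_def intro!: AE_I2) (meson abs_ge_self order_trans)+
  qed (simp add: h_def[abs_def])
  note eq = powr_integral_eq[OF h_int h a, folded J_def]
  have J0: "J s \<ge> 0" for s unfolding J_def using h by (intro integral_nonneg_AE) auto
  have J: "(\<integral>\<^sup>+u\<in>{s..t}. ennreal (g u) \<partial>lborel) = ennreal (J s)" if "s \<ge> 0" for s
  proof -
    have "(\<integral>\<^sup>+u\<in>{s..t}. ennreal (g u) \<partial>lborel) = (\<integral>\<^sup>+u. ennreal (indicator {s..} u * h u) \<partial>lborel)"
      using that by (intro nn_integral_cong) (auto simp: h_def indicator_def)
    also have "\<dots> = ennreal (J s)" unfolding J_def
      using h integrable_mult_indicator[OF _ h_int, of "{s..}"] by (intro nn_integral_eq_integral) auto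
    finally show ?thesis .
  qed
  have pos: "0 \<le> pow_real (a - 1) (J u) * h u" for u using h by (simp add: pow_real_def)
  have "(\<integral>\<^sup>+s\<in>{0..t}. ennreal_powr (\<integral>\<^sup>+u\<in>{s..t}. ennreal (g u) \<partial>lborel) (a - 1) * ennreal (g s) \<partial>lborel) =
      (\<integral>\<^sup>+s. ennreal (indicator {0..} s * (pow_real (a - 1) (J s) * h s)) \<partial>lborel)"
  proof (intro nn_integral_cong)
    fix s
    show "ennreal_powr (\<integral>\<^sup>+u\<in>{s..t}. ennreal (g u) \<partial>lborel) (a - 1) * ennreal (g s) * indicator {0..t} s =
        ennreal (indicator {0..} s * (pow_real (a - 1) (J s) * h s))"
    proof (cases "0 \<le> s \<and> s \<le> t")
      case True
      then show ?thesis
        using g(1)[of s] by (simp only: J ennreal_powr_ennreal[OF J0]) (simp add: h_def ennreal_mult pow_real_def)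
    qed (auto simp: h_def indicator_def)
  qed
  also have "\<dots> = ennreal (\<integral>s. indicator {0..} s * (pow_real (a - 1) (J s) * h s) \<partial>lborel)"
    using pos integrable_mult_indicator[OF _ eq(2), of "{0..}"] by (intro nn_integral_eq_integral) auto
  finally have "ennreal a * (\<integral>\<^sup>+s\<in>{0..t}. ennreal_powr (\<integral>\<^sup>+u\<in>{s..t}. ennreal (g u) \<partial>lborel) (a - 1) * ennreal (g s) \<partial>lborel) =
      ennreal (a * (\<integral>s. indicator {0..} s * (pow_real (a - 1) (J s) * h s) \<partial>lborel))"
    using a pos by (subst ennreal_mult) (auto intro!: integral_nonneg_AE)
  also have "\<dots> = ennreal (pow_real a (J 0))" using eq(1)[of 0] a by (simp add: pow_real_def)
  also have "\<dots> = ennreal_powr (\<integral>\<^sup>+u\<in>{0..t}. ennreal (g u) \<partial>lborel) a"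
    using J[of 0] J0 by (simp add: ennreal_powr_ennreal)
  finally show ?thesis by simp
qed

section \<open>Independence of increments\<close>

context levy_process begin

text \<open>Tonelli's theorem needs the path measurable in time and \<omega> together. The value at
  the next grid point to the right takes countably many times only, and tends to the value at s by
  right-continuity. The \<open>max\<close> freezes the path at negative times, about which the
  axioms are silent.\<close>

lemma measurable_path_joint [measurable]:
  "(\<lambda>z. X (max (fst z) 0) (snd z)) \<in> borel_measurable (borel \<Otimes>\<^sub>M M)"
proof -
  define \<kappa> where "\<kappa> n s = nat \<lfloor>real (Suc n) * max s 0\<rfloor>" for n :: nat and s :: real
  let ?t = "\<lambda>n s. real (Suc (\<kappa> n s)) / real (Suc n)"
  have meas:  "(\<lambda>z. X (?t n (fst z)) (snd z)) \<in> borel_measurable (borel \<Otimes>\<^sub>M M)" for n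
  proof (rule measurable_compose_countable[where g="\<lambda>z. \<kappa> n (fst z)"])
    show "(\<lambda>z. X (real (Suc i) / real (Suc n)) (snd z)) \<in> borel_measurable (borel \<Otimes>\<^sub>M M)" for i
      by (rule measurable_compose[OF measurable_snd]) (simp add: measurable_X)
    show "(\<lambda>z. \<kappa> n (fst z)) \<in> (borel \<Otimes>\<^sub>M M) \<rightarrow>\<^sub>M count_space UNIV"
      unfolding \<kappa>_def by measurable
  qed
  have lim: "(\<lambda>n. X (?t n (fst z)) (snd z)) \<longlonglongrightarrow> X (max (fst z) 0) (snd z)"
    if z: "z \<in> space (borel \<Otimes>\<^sub>M M)" for z
  proof -
    from z have \<omega>: "snd z \<in> space M" by (auto simp: space_pair_measure)
    define s where "s = max (fst z) 0"
    have s: "s \<ge> 0" by (simp add: s_def)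
    have t: "s \<le> ?t n (fst z)" "?t n (fst z) \<le> s + 1 / real (Suc n)" for n
    proof -
      have "real (\<kappa> n (fst z)) = of_int \<lfloor>real (Suc n) * s\<rfloor>"
        using s by (simp add: \<kappa>_def s_def[symmetric])
      then have "real (Suc n) * s \<le> real (Suc (\<kappa> n (fst z)))" "real (Suc (\<kappa> n (fst z))) \<le> real (Suc n) * s + 1"
        by linarith+
      then have "s \<le> ?t n (fst z)" "?t n (fst z) \<le> (real (Suc n) * s + 1) / real (Suc n)"
        by (auto simp: pos_le_divide_eq mult.commute intro!: divide_right_mono simp del: of_nat_Suc)
      then show "s \<le> ?t n (fst z)" "?t n (fst z) \<le> s + 1 / real (Suc n)"
        by (simp_all add: add_divide_distrib del: of_nat_Suc)
    qed
    have "(\<lambda>n. ?t n (fst z)) \<longlonglongrightarrow> s"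
    proof (rule tendsto_sandwich[of "\<lambda>_. s"])
      have "(\<lambda>n. 1 / real (Suc n)) \<longlonglongrightarrow> 0" by (rule LIMSEQ_Suc) (rule lim_const_over_n)
      from tendsto_add[OF tendsto_const[of s] this] show "(\<lambda>n. s + 1 / real (Suc n)) \<longlonglongrightarrow> s" by simp
    qed (use t in auto)
    moreover have "continuous (at s within {s..}) (\<lambda>s. X s (snd z))"
      using right_continuous[OF \<omega> s] by (simp add: at_within_Ici_at_right)
    ultimately show ?thesis
      using t(1) by (simp add: continuous_within_sequentially comp_def s_def)
  qed
  from meas lim show ?thesis by (rule borel_measurable_LIMSEQ_metric)
qed

lemma measurable_path_compose [measurable (raw)]:
  assumes "f \<in> borel_measurable N" "g \<in> N \<rightarrow>\<^sub>M M"
  shows "(\<lambda>x. X (max (f x) 0) (g x)) \<in> borel_measurable N"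
proof -
  have "(\<lambda>x. (f x, g x)) \<in> N \<rightarrow>\<^sub>M borel \<Otimes>\<^sub>M M" using assms by measurable
  from measurable_compose[OF this measurable_path_joint] show ?thesis by simp
qed

lemma measurable_path: "\<omega> \<in> space M \<Longrightarrow> (\<lambda>s. X (max s 0) \<omega>) \<in> borel_measurable borel"
  by measurable

lemma path_bounded:
  assumes "\<omega> \<in> space M" "T \<ge> 0"
  obtains C where "\<And>s. 0 \<le> s \<Longrightarrow> s \<le> T \<Longrightarrow> \<bar>X s \<omega>\<bar> \<le> C"
  using cadlag_bounded[OF right_continuous[OF assms(1)] left_limits[OF assms(1)] assms(2)] by metis

definition shifted_functional :: "real \<Rightarrow> real \<Rightarrow> 'a \<Rightarrow> real" where
  "shifted_functional s r \<omega> = (LINT u:{0<..r}|lborel. exp (- (X (max (s + u) 0) \<omega> - X s \<omega>)))"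

lemma measurable_shifted_functional [measurable]:
  "s \<ge> 0 \<Longrightarrow> shifted_functional s r \<in> borel_measurable M"
  unfolding shifted_functional_def[abs_def] set_lebesgue_integral_def
  using measurable_X[of s] by measurable

text \<open>Each Riemann sum is a function of finitely many increments after s, which is the form in
  which independence can be used. The second part ties the real integral to the one in
  [0, \<infinity>]; the added end point 0 is a null set.\<close>

lemma shifted_functional_riemann:
  assumes \<omega>: "\<omega> \<in> space M" and "s \<ge> 0" "r > 0"
  shows "(\<lambda>n. r / real (Suc n) * (\<Sum>k=1..Suc n. exp (- (X (s + r * real k / real (Suc n)) \<omega> - X s \<omega>))))
    \<longlonglongrightarrow> shifted_functional s r \<omega>"
    and "(\<integral>\<^sup>+u\<in>{0..r}. ennreal (exp (- (X (max (s + u) 0) \<omega> - X s \<omega>))) \<partial>lborel) =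
      ennreal (shifted_functional s r \<omega>)"
proof -
  define g where "g u = exp (- (X (max (s + u) 0) \<omega> - X s \<omega>))" for u
  have [measurable]: "g \<in> borel_measurable borel"
    unfolding g_def[abs_def] using \<omega> measurable_path[OF \<omega>] by measurable
  obtain C where C: "\<And>u. 0 \<le> u \<Longrightarrow> u \<le> s + r \<Longrightarrow> \<bar>X u \<omega>\<bar> \<le> C"
    using path_bounded[OF \<omega>, of "s + r"] assms by auto
  have bound: "\<bar>g u\<bar> \<le> exp (2 * C)" if "0 \<le> u" "u \<le> r" for u
    using C[of "s + u"] C[of s] that assms by (auto simp: g_def)
  have cont: "continuous (at_right u) g" if "u \<ge> 0" for u
  proof -
    have "((\<lambda>v. X v \<omega>) \<longlongrightarrow> X (s + u) \<omega>) (at_right (s + u))"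
      using right_continuous[OF \<omega>, of "s + u"] assms that by (simp add: continuous_within)
    then have "((\<lambda>v. X (v + s) \<omega>) \<longlongrightarrow> X (s + u) \<omega>) (at_right u)"
      by (simp add: at_right_to_0[of u] at_right_to_0[of "s + u"] filterlim_filtermap add_ac)
    then have "((\<lambda>v. exp (- (X (v + s) \<omega> - X s \<omega>))) \<longlongrightarrow> g u) (at_right u)"
      using assms that by (auto intro!: tendsto_intros simp: g_def)
    moreover have "\<forall>\<^sub>F v in at_right u. exp (- (X (v + s) \<omega> - X s \<omega>)) = g v"
      using assms that by (auto simp: eventually_at_filter g_def add_ac intro!: always_eventually)
    ultimately show ?thesis unfolding continuous_within using tendsto_cong by fast
  qed
  have "(\<lambda>n. r / real (Suc n) * (\<Sum>k=1..Suc n. g (r * real k / real (Suc n)))) \<longlonglongrightarrow> (LINT u:{0<..r}|lborel. g u)"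
    by (rule riemann_sum_right_continuous[OF _ _ cont bound]) (use assms in auto)
  moreover have "g (r * real k / real (Suc n)) = exp (- (X (s + r * real k / real (Suc n)) \<omega> - X s \<omega>))" for k n
    using assms by (simp add: g_def)
  ultimately show "(\<lambda>n. r / real (Suc n) * (\<Sum>k=1..Suc n. exp (- (X (s + r * real k / real (Suc n)) \<omega> - X s \<omega>))))
    \<longlonglongrightarrow> shifted_functional s r \<omega>"
    by (simp only: shifted_functional_def g_def)
  have "integrable lborel (\<lambda>u. indicator {0<..r} u *\<^sub>R g u)"
  proof (rule Bochner_Integration.integrable_bound)
    show "integrable lborel (\<lambda>u. indicator {0<..r} u * exp (2 * C))" using assms by simp
  qed (use bound in \<open>auto simp: indicator_def\<close>)
  then have "(\<integral>\<^sup>+u. ennreal (indicator {0<..r} u *\<^sub>R g u) \<partial>lborel) = ennreal (LINT u:{0<..r}|lborel. g u)"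
    unfolding set_lebesgue_integral_def by (intro nn_integral_eq_integral) (auto simp: g_def)
  moreover have "(\<integral>\<^sup>+u. ennreal (indicator {0<..r} u *\<^sub>R g u) \<partial>lborel) = (\<integral>\<^sup>+u\<in>{0..r}. ennreal (g u) \<partial>lborel)"
    using AE_lborel_singleton[of 0] by (intro nn_integral_cong_AE) (auto simp: indicator_def)
  ultimately show "(\<integral>\<^sup>+u\<in>{0..r}. ennreal (exp (- (X (max (s + u) 0) \<omega> - X s \<omega>))) \<partial>lborel) =
      ennreal (shifted_functional s r \<omega>)"
    by (simp add: shifted_functional_def g_def)
qed

text \<open>\<open>X s\<close> and the Riemann sum are functions of disjoint blocks of increments,
  hence independent. By stationarity the later block has as law the N-fold product of the law of
  \<open>X (r / real N)\<close>, whatever s is, so the second factor may be computed with s =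
  0.\<close>

lemma riemann_sum_independent:
  fixes f h :: "real \<Rightarrow> real"
  assumes s: "s \<ge> 0" and r: "r > 0"
    and [measurable]: "f \<in> borel_measurable borel" "h \<in> borel_measurable borel"
    and f: "\<And>x. \<bar>f x\<bar> \<le> Cf" and h: "\<And>x. \<bar>h x\<bar> \<le> Ch"
  defines "S \<equiv> \<lambda>s n \<omega>. r / real (Suc n) * (\<Sum>k=1..Suc n. exp (- (X (s + r * real k / real (Suc n)) \<omega> - X s \<omega>)))"
  shows "expectation (\<lambda>\<omega>. f (X s \<omega>) * h (S s n \<omega>)) = expectation (\<lambda>\<omega>. f (X s \<omega>)) * expectation (\<lambda>\<omega>. h (S 0 n \<omega>))"
proof -
  define N where "N = Suc n"
  \<comment> \<open>The partition 0, s, s + r/N, ..., s + r: increment 0 is \<open>X s\<close> and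
    the increments 1 to N carry the Riemann sum.\<close>
  define \<tau> where "\<tau> s i = (case i of 0 \<Rightarrow> 0 | Suc j \<Rightarrow> s + r * real j / real N)" for s :: real and i
  define Y where "Y s i \<omega> = X (\<tau> s (Suc i)) \<omega> - X (\<tau> s i) \<omega>" for s i \<omega>
  define P where "P = PiM {1..N} (\<lambda>_. borel :: real measure)"
  \<comment> \<open>Partial sums of the increments give back
    \<open>X (s + r * real k / real N) - X s\<close>, so H does not refer to s.\<close>
  define H where "H y = h (r / real N * (\<Sum>k=1..N. exp (- (\<Sum>i=1..k. y i))))" for y :: "nat \<Rightarrow> real"
  have H_meas [measurable]: "H \<in> borel_measurable P"
  proof -
    have "(\<lambda>y. y i) \<in> borel_measurable P" if "i \<in> {1..k}" "k \<in> {1..N}" for i k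
      unfolding P_def using that by (intro measurable_component_singleton) auto
    then have "(\<lambda>y. r / real N * (\<Sum>k=1..N. exp (- (\<Sum>i=1..k. y i)))) \<in> borel_measurable P"
      by (intro borel_measurable_times borel_measurable_const borel_measurable_sum
          measurable_compose[OF _ borel_measurable_exp] borel_measurable_uminus) auto
    then show ?thesis unfolding H_def[abs_def] by measurable
  qed
  have \<tau>: "mono (\<tau> s)" "\<tau> s i \<ge> 0" if "s \<ge> 0" for s i
  proof -
    show "mono (\<tau> s)"
      by (rule incseq_SucI) (use that r in \<open>auto simp: \<tau>_def divide_right_mono split: nat.split\<close>)
    show "\<tau> s i \<ge> 0" using that r by (auto simp: \<tau>_def split: nat.split)
  qed
  have Y_indep: "indep_vars (\<lambda>_. borel) (Y s) {..<Suc N}" if "s \<ge> 0" for s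
    unfolding Y_def[abs_def] using \<tau>[OF that] by (rule independent_increments)
  have Y_meas [measurable]: "Y s i \<in> borel_measurable M" if "s \<ge> 0" for s i
    unfolding Y_def[abs_def] using \<tau>(2)[OF that] by (intro borel_measurable_diff measurable_X)
  have Y_sum: "(\<Sum>i=1..k. Y s i \<omega>) = X (s + r * real k / real N) \<omega> - X s \<omega>" for s k \<omega>
  proof (induction k)
    case (Suc k)
    then show ?case by (simp add: Y_def \<tau>_def)
  qed simp
  have S_eq: "h (S s n \<omega>) = H (\<lambda>i\<in>{1..N}. Y s i \<omega>)" for s \<omega>
  proof -
    have "(\<Sum>i=1..k. (\<lambda>i\<in>{1..N}. Y s i \<omega>) i) = X (s + r * real k / real N) \<omega> - X s \<omega>" if "k \<in> {1..N}" for k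
      unfolding Y_sum[symmetric] using that by (intro sum.cong) auto
    then show ?thesis unfolding H_def S_def N_def by simp
  qed
  have restr_meas: "(\<lambda>\<omega>. \<lambda>i\<in>{1..N}. Y s i \<omega>) \<in> M \<rightarrow>\<^sub>M P" if "s \<ge> 0" for s
    unfolding P_def using Y_meas[OF that] by (intro measurable_restrict) auto
  have law: "distr M P (\<lambda>\<omega>. \<lambda>i\<in>{1..N}. Y s i \<omega>) = PiM {1..N} (\<lambda>_. distr M borel (X (r / real N)))" if "s \<ge> 0" for s
  proof -
    have "indep_vars (\<lambda>_. borel) (Y s) {1..N}"
      using Y_indep[OF that] by (rule indep_vars_subset) auto
    then have "distr M P (\<lambda>\<omega>. \<lambda>i\<in>{1..N}. Y s i \<omega>) = PiM {1..N} (\<lambda>i. distr M borel (Y s i))"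
      unfolding P_def using Y_meas[OF that] by (subst (asm) indep_vars_iff_distr_eq_PiM') (auto simp: N_def)
    also have "\<dots> = PiM {1..N} (\<lambda>_. distr M borel (X (r / real N)))"
    proof (rule PiM_cong)
      fix i assume "i \<in> {1..N}"
      then obtain j where i: "i = Suc j" by (cases i) auto
      have "Y s i = (\<lambda>\<omega>. X ((s + r * real j / real N) + r / real N) \<omega> - X (s + r * real j / real N) \<omega>)"
        by (auto simp: Y_def \<tau>_def i distrib_left add_divide_distrib add_ac)
      moreover have "s + r * real j / real N \<ge> 0" "r / real N \<ge> 0" using that r by auto
      ultimately show "distr M borel (Y s i) = distr M borel (X (r / real N))"
        using stationary_increments by simp
    qed simp
    finally show ?thesis .
  qed
  have expect: "expectation (\<lambda>\<omega>. h (S s n \<omega>)) = expectation (\<lambda>\<omega>. h (S 0 n \<omega>))"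
  proof -
    have "expectation (\<lambda>\<omega>. h (S s n \<omega>)) = integral\<^sup>L (PiM {1..N} (\<lambda>_. distr M borel (X (r / real N)))) H" if "s \<ge> 0" for s
      unfolding law[OF that, symmetric] S_eq by (rule integral_distr[OF restr_meas[OF that] H_meas, symmetric])
    from this[OF s] this[of 0] show ?thesis by simp
  qed
  have "indep_var (PiM {0} (\<lambda>_. borel)) (\<lambda>\<omega>. \<lambda>i\<in>{0}. Y s i \<omega>) P (\<lambda>\<omega>. \<lambda>i\<in>{1..N}. Y s i \<omega>)"
    unfolding P_def by (rule indep_var_restrict[OF Y_indep[OF s]]) auto
  then have "indep_var borel ((\<lambda>y. f (y 0)) \<circ> (\<lambda>\<omega>. \<lambda>i\<in>{0}. Y s i \<omega>)) borel (H \<circ> (\<lambda>\<omega>. \<lambda>i\<in>{1..N}. Y s i \<omega>))"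
    by (rule indep_var_compose) (use measurable_compose[OF measurable_component_singleton] in auto)
  then have ind: "indep_var borel (\<lambda>\<omega>. f (Y s 0 \<omega>)) borel (\<lambda>\<omega>. h (S s n \<omega>))"
    by (simp add: comp_def S_eq)
  have "expectation (\<lambda>\<omega>. f (Y s 0 \<omega>) * h (S s n \<omega>)) = expectation (\<lambda>\<omega>. f (Y s 0 \<omega>)) * expectation (\<lambda>\<omega>. h (S s n \<omega>))"
  proof (rule indep_var_lebesgue_integral[OF ind])
    show "integrable M (\<lambda>\<omega>. f (Y s 0 \<omega>))"
      using f Y_meas[OF s] by (intro integrable_const_bound[of _ Cf]) auto
    show "integrable M (\<lambda>\<omega>. h (S s n \<omega>))"
      unfolding S_eq using h measurable_compose[OF restr_meas[OF s] H_meas]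
      by (intro integrable_const_bound[of _ Ch]) (auto simp: H_def)
  qed
  moreover have "Y s 0 \<omega> = X s \<omega>" if "\<omega> \<in> space M" for \<omega>
    using that by (simp add: Y_def \<tau>_def X_0)
  ultimately show ?thesis
    unfolding expect by (simp cong: Bochner_Integration.integral_cong)
qed

text \<open>The Riemann sums converge on every path; continuity of h transports this limit, and
  boundedness takes it through the expectation.\<close>

lemma shifted_functional_independent_bounded:
  fixes f h :: "real \<Rightarrow> real"
  assumes s: "s \<ge> 0" and r: "r > 0"
    and fc: "continuous_on UNIV f" and hc: "continuous_on UNIV h"
    and f: "\<And>x. \<bar>f x\<bar> \<le> Cf" and h: "\<And>x. \<bar>h x\<bar> \<le> Ch"
  shows "expectation (\<lambda>\<omega>. f (X s \<omega>) * h (shifted_functional s r \<omega>)) =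
    expectation (\<lambda>\<omega>. f (X s \<omega>)) * expectation (\<lambda>\<omega>. h (shifted_functional 0 r \<omega>))"
proof -
  define S where "S s n \<omega> = r / real (Suc n) * (\<Sum>k=1..Suc n. exp (- (X (s + r * real k / real (Suc n)) \<omega> - X s \<omega>)))" for s n \<omega>
  have [measurable]: "f \<in> borel_measurable borel" "h \<in> borel_measurable borel"
    using fc hc by (auto intro: borel_measurable_continuous_onI)
  have S_meas: "S s n \<in> borel_measurable M" if "s \<ge> 0" for s n
    unfolding S_def[abs_def] using that r
    by (intro borel_measurable_times borel_measurable_const borel_measurable_sum
          measurable_compose[OF _ borel_measurable_exp] borel_measurable_uminus borel_measurable_diff measurable_X) auto
  have h_lim: "(\<lambda>n. h (S s n \<omega>)) \<longlonglongrightarrow> h (shifted_functional s r \<omega>)" if "s \<ge> 0" "\<omega> \<in> space M" for s \<omega>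
    using shifted_functional_riemann(1)[OF that(2,1) r] hc
    by (intro continuous_on_tendsto_compose[OF hc]) (auto simp: S_def)
  \<comment> \<open>Stated for a general g because it serves twice: with f at time s for the joint
    expectation, and with the constant 1 at time 0 for the second factor alone.\<close>
  have lim: "(\<lambda>n. expectation (\<lambda>\<omega>. g (X s \<omega>) * h (S s n \<omega>))) \<longlonglongrightarrow> expectation (\<lambda>\<omega>. g (X s \<omega>) * h (shifted_functional s r \<omega>))"
    if s: "s \<ge> 0" and [measurable]: "g \<in> borel_measurable borel" and g: "\<And>x. \<bar>g x\<bar> \<le> Cg" for g :: "real \<Rightarrow> real" and s Cg
  proof (rule integral_dominated_convergence[where w="\<lambda>_. Cg * Ch"])
    note [measurable] = S_meas[OF s] measurable_X[OF s] measurable_shifted_functional[OF s]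
    show "(\<lambda>\<omega>. g (X s \<omega>) * h (shifted_functional s r \<omega>)) \<in> borel_measurable M" by measurable
    show "(\<lambda>\<omega>. g (X s \<omega>) * h (S s n \<omega>)) \<in> borel_measurable M" for n by measurable
    show "AE \<omega> in M. (\<lambda>n. g (X s \<omega>) * h (S s n \<omega>)) \<longlonglongrightarrow> g (X s \<omega>) * h (shifted_functional s r \<omega>)"
      using h_lim[OF s] by (auto intro!: tendsto_intros)
    show "AE \<omega> in M. norm (g (X s \<omega>) * h (S s n \<omega>)) \<le> Cg * Ch" for n
      using g h by (auto simp: abs_mult intro!: mult_mono order_trans[OF abs_ge_zero g])
  qed simp
  have "expectation (\<lambda>\<omega>. f (X s \<omega>) * h (S s n \<omega>)) = expectation (\<lambda>\<omega>. f (X s \<omega>)) * expectation (\<lambda>\<omega>. h (S 0 n \<omega>))" for n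
    unfolding S_def by (rule riemann_sum_independent[OF s r _ _ f h]) auto
  moreover have "(\<lambda>n. expectation (\<lambda>\<omega>. f (X s \<omega>)) * expectation (\<lambda>\<omega>. h (S 0 n \<omega>)))
     \<longlonglongrightarrow> expectation (\<lambda>\<omega>. f (X s \<omega>)) * expectation (\<lambda>\<omega>. h (shifted_functional 0 r \<omega>))"
    using lim[of 0 "\<lambda>_. 1" 1] by (auto intro!: tendsto_intros)
  moreover have "(\<lambda>n. expectation (\<lambda>\<omega>. f (X s \<omega>) * h (S s n \<omega>))) \<longlonglongrightarrow>
      expectation (\<lambda>\<omega>. f (X s \<omega>) * h (shifted_functional s r \<omega>))"
    by (rule lim[OF s _ f]) simp
  ultimately show ?thesis using LIMSEQ_unique by simp
qed

end

lemma measurable_ennreal_powr [measurable]: "(\<lambda>x. ennreal_powr x a) \<in> borel_measurable borel"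
  unfolding ennreal_powr_def by measurable

lemma ennreal_powr_mono: "x \<le> y \<Longrightarrow> a \<ge> 0 \<Longrightarrow> ennreal_powr x a \<le> ennreal_powr y a"
  by (cases x; cases y) (auto simp: ennreal_powr_def top_unique intro!: ennreal_leI powr_mono2)

lemma SUP_min_of_nat: "(SUP n. ennreal (min c (real n))) = ennreal c"
proof (rule antisym)
  obtain N where "c \<le> real N" using real_arch_simple by blast
  then have "ennreal c = ennreal (min c (real N))" by (simp add: min_absorb1)
  also have "\<dots> \<le> (SUP n. ennreal (min c (real n)))" by (rule SUP_upper) simp
  finally show "ennreal c \<le> (SUP n. ennreal (min c (real n)))" .
qed (auto intro!: SUP_least ennreal_leI)

context levy_process begin

lemma shifted_functional_nonneg: "shifted_functional s r \<omega> \<ge> 0"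
  unfolding shifted_functional_def set_lebesgue_integral_def by (intro integral_nonneg_AE) auto

text \<open>The functions of interest are unbounded, so they are truncated at separate levels n and
  m. Monotone convergence removes both truncations in [0, \<infinity>], and the identity survives
  even if an expectation is infinite.\<close>

lemma shifted_functional_independent:
  assumes s: "s \<ge> 0" and r: "r > 0" and b: "b \<ge> 0"
  shows "(\<integral>\<^sup>+\<omega>. ennreal (exp (- a * X s \<omega>)) * ennreal (pow_real b (shifted_functional s r \<omega>)) \<partial>M) =
    (\<integral>\<^sup>+\<omega>. ennreal (exp (- a * X s \<omega>)) \<partial>M) * (\<integral>\<^sup>+\<omega>. ennreal (pow_real b (shifted_functional 0 r \<omega>)) \<partial>M)"
proof -
  note [measurable] = measurable_X[OF s] measurable_shifted_functional[OF s] measurable_shifted_functional[OF order_refl]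
  define f where "f n x = min (exp (- a * x)) (real n)" for n x
  \<comment> \<open>The \<open>max\<close> makes the power continuous on the whole line without
    changing it on the nonnegative values that occur.\<close>
  define h where "h n y = min (pow_real b (max y 0)) (real n)" for n y
  have fc: "continuous_on UNIV (f n)" for n
    unfolding f_def by (intro continuous_intros)
  have hc: "continuous_on UNIV (h n)" for n
    using b unfolding h_def pow_real_def
    by (cases "b = 0") (auto intro!: continuous_intros continuous_on_powr')
  have [measurable]: "f n \<in> borel_measurable borel" "h n \<in> borel_measurable borel" for n
    using fc hc by (auto intro: borel_measurable_continuous_onI)
  have f: "0 \<le> f n x" "\<bar>f n x\<bar> \<le> real n" and h: "0 \<le> h n x" "\<bar>h n x\<bar> \<le> real n" for n x
    by (auto simp: f_def h_def pow_real_def min_def)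
  have f_SUP: "ennreal (exp (- a * x)) = (SUP n. ennreal (f n x))" for x
    unfolding f_def SUP_min_of_nat ..
  have h_SUP: "ennreal (pow_real b (shifted_functional s r \<omega>)) = (SUP n. ennreal (h n (shifted_functional s r \<omega>)))" for s \<omega>
    unfolding h_def SUP_min_of_nat by (simp add: shifted_functional_nonneg max_absorb1)
  have mono: "incseq (\<lambda>n. ennreal (f n x))" "incseq (\<lambda>n. ennreal (h n x))" for x
    by (auto simp: incseq_def f_def h_def intro!: ennreal_leI)
  have bounded: "(\<integral>\<^sup>+\<omega>. ennreal (f n (X s \<omega>)) * ennreal (h m (shifted_functional s r \<omega>)) \<partial>M) =
    (\<integral>\<^sup>+\<omega>. ennreal (f n (X s \<omega>)) \<partial>M) * (\<integral>\<^sup>+\<omega>. ennreal (h m (shifted_functional 0 r \<omega>)) \<partial>M)" for n m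
  proof -
    have i: "integrable M (\<lambda>\<omega>. f n (X s \<omega>) * h m (shifted_functional s r \<omega>))"
    proof (rule integrable_const_bound)
      show "AE \<omega> in M. norm (f n (X s \<omega>) * h m (shifted_functional s r \<omega>)) \<le> real n * real m"
        using f h by (auto simp: abs_mult intro!: mult_mono)
    qed simp
    have i1: "integrable M (\<lambda>\<omega>. f n (X s \<omega>))"
      using f by (intro integrable_const_bound[of _ "real n"]) auto
    have i2: "integrable M (\<lambda>\<omega>. h m (shifted_functional 0 r \<omega>))"
      using h by (intro integrable_const_bound[of _ "real m"]) auto
    have "(\<integral>\<^sup>+\<omega>. ennreal (f n (X s \<omega>)) * ennreal (h m (shifted_functional s r \<omega>)) \<partial>M) =
      ennreal (expectation (\<lambda>\<omega>. f n (X s \<omega>) * h m (shifted_functional s r \<omega>)))"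
      using f h by (subst nn_integral_eq_integral[OF i, symmetric]) (auto simp: ennreal_mult)
    also have "\<dots> = ennreal (expectation (\<lambda>\<omega>. f n (X s \<omega>)) * expectation (\<lambda>\<omega>. h m (shifted_functional 0 r \<omega>)))"
      by (subst shifted_functional_independent_bounded[OF s r fc hc f(2) h(2)]) simp
    also have "\<dots> = (\<integral>\<^sup>+\<omega>. ennreal (f n (X s \<omega>)) \<partial>M) * (\<integral>\<^sup>+\<omega>. ennreal (h m (shifted_functional 0 r \<omega>)) \<partial>M)"
      using f h by (subst ennreal_mult) (auto simp: nn_integral_eq_integral[OF i1] nn_integral_eq_integral[OF i2] intro!: integral_nonneg_AE)
    finally show ?thesis .
  qed
  have "(\<integral>\<^sup>+\<omega>. ennreal (exp (- a * X s \<omega>)) * ennreal (pow_real b (shifted_functional s r \<omega>)) \<partial>M) =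
      (\<integral>\<^sup>+\<omega>. (SUP m. SUP n. ennreal (f n (X s \<omega>)) * ennreal (h m (shifted_functional s r \<omega>))) \<partial>M)"
    unfolding f_SUP h_SUP SUP_mult_left_ennreal by (simp add: SUP_mult_right_ennreal)
  also have "\<dots> = (SUP m. \<integral>\<^sup>+\<omega>. (SUP n. ennreal (f n (X s \<omega>)) * ennreal (h m (shifted_functional s r \<omega>))) \<partial>M)"
    using mono by (intro nn_integral_monotone_convergence_SUP)
      (auto simp: incseq_def le_fun_def intro!: SUP_mono' mult_left_mono)
  also have "\<dots> = (SUP m. SUP n. \<integral>\<^sup>+\<omega>. ennreal (f n (X s \<omega>)) * ennreal (h m (shifted_functional s r \<omega>)) \<partial>M)"
    using mono by (intro SUP_cong refl nn_integral_monotone_convergence_SUP)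
      (auto simp: incseq_def le_fun_def intro!: mult_right_mono)
  also have "\<dots> = (SUP n. \<integral>\<^sup>+\<omega>. ennreal (f n (X s \<omega>)) \<partial>M) * (SUP m. \<integral>\<^sup>+\<omega>. ennreal (h m (shifted_functional 0 r \<omega>)) \<partial>M)"
    unfolding bounded SUP_mult_right_ennreal[symmetric] SUP_mult_left_ennreal[symmetric] ..
  also have "(SUP n. \<integral>\<^sup>+\<omega>. ennreal (f n (X s \<omega>)) \<partial>M) = (\<integral>\<^sup>+\<omega>. ennreal (exp (- a * X s \<omega>)) \<partial>M)"
    unfolding f_SUP using mono by (intro nn_integral_monotone_convergence_SUP[symmetric]) (auto simp: incseq_def le_fun_def)
  also have "(SUP m. \<integral>\<^sup>+\<omega>. ennreal (h m (shifted_functional 0 r \<omega>)) \<partial>M) =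
      (\<integral>\<^sup>+\<omega>. ennreal (pow_real b (shifted_functional 0 r \<omega>)) \<partial>M)"
    unfolding h_SUP using mono by (intro nn_integral_monotone_convergence_SUP[symmetric]) (auto simp: incseq_def le_fun_def)
  finally show ?thesis .
qed

section \<open>Convolution formula for the moments and its transform\<close>

lemma exp_functional_eq:
  "exp_functional X t \<omega> = (\<integral>\<^sup>+u\<in>{0..t}. ennreal (exp (- X (max u 0) \<omega>)) \<partial>lborel)"
  "exp_functional_inf X \<omega> = (\<integral>\<^sup>+u\<in>{0..}. ennreal (exp (- X (max u 0) \<omega>)) \<partial>lborel)"
  unfolding exp_functional_def exp_functional_inf_def
  by (intro nn_integral_cong; auto simp: indicator_def max_absorb1)+

lemma measurable_exp_functional_joint [measurable]:
  "(\<lambda>z. exp_functional X (fst z) (snd z)) \<in> borel_measurable (borel \<Otimes>\<^sub>M M)"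
proof -
  \<comment> \<open>The interval of integration depends on time; written as a fixed set of pairs,
    its indicator is visibly measurable in both variables.\<close>
  have "(\<lambda>(z, u). ennreal (exp (- X (max u 0) (snd z))) * indicator {w. 0 \<le> snd w \<and> snd w \<le> fst w} (fst z, u))
      \<in> borel_measurable ((borel \<Otimes>\<^sub>M M) \<Otimes>\<^sub>M lborel)"
    by measurable
  then have "(\<lambda>z. \<integral>\<^sup>+u. ennreal (exp (- X (max u 0) (snd z))) * indicator {w. 0 \<le> snd w \<and> snd w \<le> fst w} (fst z, u) \<partial>lborel)
      \<in> borel_measurable (borel \<Otimes>\<^sub>M M)"
    by (rule lborel.borel_measurable_nn_integral)
  then show ?thesis
    unfolding exp_functional_eq by (simp add: indicator_def)
qed

lemma measurable_exp_functional [measurable]: "exp_functional X t \<in> borel_measurable M"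
proof -
  have "(\<lambda>\<omega>. (t, \<omega>)) \<in> M \<rightarrow>\<^sub>M borel \<Otimes>\<^sub>M M" by measurable
  from measurable_compose[OF this measurable_exp_functional_joint] show ?thesis by simp
qed

lemma measurable_exp_functional_inf [measurable]: "exp_functional_inf X \<in> borel_measurable M"
proof -
  have "(\<lambda>\<omega>. \<integral>\<^sup>+u. ennreal (exp (- X (max u 0) \<omega>)) * indicator {0..} u \<partial>lborel) \<in> borel_measurable M"
    by measurable
  then show ?thesis by (simp add: exp_functional_eq[abs_def])
qed

lemma measurable_moment [measurable]: "moment M X a \<in> borel_measurable borel"
proof -
  have "(\<lambda>(t, \<omega>). ennreal_powr (exp_functional X t \<omega>) a) \<in> borel_measurable (borel \<Otimes>\<^sub>M M)"
    using measurable_compose[OF measurable_exp_functional_joint measurable_ennreal_powr] by (simp add: split_beta)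
  then show ?thesis unfolding moment_def[abs_def] by (rule borel_measurable_nn_integral)
qed

lemma exp_functional_eq_shifted:
  "\<omega> \<in> space M \<Longrightarrow> t > 0 \<Longrightarrow> exp_functional X t \<omega> = ennreal (shifted_functional 0 t \<omega>)"
  using shifted_functional_riemann(2)[of \<omega> 0 t] by (simp add: exp_functional_eq X_0)

lemma exp_functional_tail:
  assumes \<omega>: "\<omega> \<in> space M" and s: "0 \<le> s" "s < t"
  shows "(\<integral>\<^sup>+u\<in>{s..t}. ennreal (exp (- X (max u 0) \<omega>)) \<partial>lborel) =
    ennreal (exp (- X s \<omega>) * shifted_functional s (t - s) \<omega>)"
proof -
  note [measurable] = measurable_path[OF \<omega>]
  have "(\<integral>\<^sup>+u\<in>{s..t}. ennreal (exp (- X (max u 0) \<omega>)) \<partial>lborel) =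
      (\<integral>\<^sup>+u. ennreal (exp (- X (max (s + u) 0) \<omega>)) * indicator {s..t} (s + u) \<partial>lborel)"
    using nn_integral_real_affine[of "\<lambda>u. ennreal (exp (- X (max u 0) \<omega>)) * indicator {s..t} u" 1 s] by simp
  also have "\<dots> = (\<integral>\<^sup>+u. ennreal (exp (- X s \<omega>)) * (ennreal (exp (- (X (max (s + u) 0) \<omega> - X s \<omega>))) * indicator {0..t - s} u) \<partial>lborel)"
    by (intro nn_integral_cong) (auto simp: indicator_def simp flip: ennreal_mult exp_add)
  also have "\<dots> = ennreal (exp (- X s \<omega>)) * (\<integral>\<^sup>+u\<in>{0..t - s}. ennreal (exp (- (X (max (s + u) 0) \<omega> - X s \<omega>))) \<partial>lborel)"
    by (rule nn_integral_cmult) simp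
  also have "\<dots> = ennreal (exp (- X s \<omega>) * shifted_functional s (t - s) \<omega>)"
    using shifted_functional_riemann(2)[OF \<omega>, of s "t - s"] s
    by (simp add: ennreal_mult shifted_functional_nonneg)
  finally show ?thesis .
qed

lemma moment_convolution:
  assumes a: "a \<ge> 1"
  shows "moment M X a t = ennreal a * (\<integral>\<^sup>+s\<in>{0..t}. (\<integral>\<^sup>+\<omega>. ennreal (exp (- a * X (max s 0) \<omega>)) \<partial>M) * moment M X (a - 1) (t - s) \<partial>lborel)"
proof -
  define G where "G s \<omega> = ennreal_powr (\<integral>\<^sup>+u\<in>{s..t}. ennreal (exp (- X (max u 0) \<omega>)) \<partial>lborel) (a - 1) *
      ennreal (exp (- X (max s 0) \<omega>))" for s \<omega>
  have "(\<lambda>(z, u). ennreal (exp (- X (max u 0) (snd z))) * indicator {w. fst w \<le> snd w \<and> snd w \<le> t} (fst z, u))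
      \<in> borel_measurable ((borel \<Otimes>\<^sub>M M) \<Otimes>\<^sub>M lborel)"
    by measurable
  then have "(\<lambda>z. \<integral>\<^sup>+u. ennreal (exp (- X (max u 0) (snd z))) * indicator {w. fst w \<le> snd w \<and> snd w \<le> t} (fst z, u) \<partial>lborel)
      \<in> borel_measurable (borel \<Otimes>\<^sub>M M)"
    by (rule lborel.borel_measurable_nn_integral)
  then have [measurable]: "(\<lambda>z. \<integral>\<^sup>+u\<in>{fst z..t}. ennreal (exp (- X (max u 0) (snd z))) \<partial>lborel) \<in> borel_measurable (borel \<Otimes>\<^sub>M M)"
    by (simp add: indicator_def)
  have G_meas: "(\<lambda>z. G (fst z) (snd z)) \<in> borel_measurable (borel \<Otimes>\<^sub>M M)"
    unfolding G_def by measurable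
  have path: "ennreal_powr (exp_functional X t \<omega>) a = ennreal a * (\<integral>\<^sup>+s. G s \<omega> * indicator {0..t} s \<partial>lborel)"
    if \<omega>: "\<omega> \<in> space M" for \<omega>
  proof -
    obtain C where C: "\<And>s. 0 \<le> s \<Longrightarrow> s \<le> max t 0 \<Longrightarrow> \<bar>X s \<omega>\<bar> \<le> C"
      using path_bounded[OF \<omega>, of "max t 0"] by auto
    show ?thesis unfolding exp_functional_eq G_def
    proof (rule ennreal_powr_nn_integral_eq[OF _ _ _ a])
      show "exp (- X (max u 0) \<omega>) \<le> exp C" if "0 \<le> u" "u \<le> t" for u
        using C[of u] that by (simp add: le_max_iff_disj)
    qed (use measurable_path[OF \<omega>] in auto)
  qed
  interpret pair_sigma_finite M lborel ..
  have "moment M X a t = (\<integral>\<^sup>+\<omega>. ennreal a * (\<integral>\<^sup>+s. G s \<omega> * indicator {0..t} s \<partial>lborel) \<partial>M)"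
    unfolding moment_def by (intro nn_integral_cong path)
  also have "\<dots> = ennreal a * (\<integral>\<^sup>+\<omega>. (\<integral>\<^sup>+s. G s \<omega> * indicator {0..t} s \<partial>lborel) \<partial>M)"
  proof (rule nn_integral_cmult)
    have "(\<lambda>(\<omega>, s). G s \<omega> * indicator {0..t} s) \<in> borel_measurable (M \<Otimes>\<^sub>M lborel)"
      using measurable_compose[OF measurable_pair_swap' G_meas] by (simp add: split_beta' cong: measurable_cong_sets)
    then show "(\<lambda>\<omega>. \<integral>\<^sup>+s. G s \<omega> * indicator {0..t} s \<partial>lborel) \<in> borel_measurable M"
      by (rule lborel.borel_measurable_nn_integral)
  qed
  also have "(\<integral>\<^sup>+\<omega>. (\<integral>\<^sup>+s. G s \<omega> * indicator {0..t} s \<partial>lborel) \<partial>M) = (\<integral>\<^sup>+s. (\<integral>\<^sup>+\<omega>. G s \<omega> * indicator {0..t} s \<partial>M) \<partial>lborel)"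
  proof (rule Fubini'[symmetric])
    show "(\<lambda>(\<omega>, s). G s \<omega> * indicator {0..t} s) \<in> borel_measurable (M \<Otimes>\<^sub>M lborel)"
      using measurable_compose[OF measurable_pair_swap' G_meas] by (simp add: split_beta' cong: measurable_cong_sets)
  qed
  also have "\<dots> = (\<integral>\<^sup>+s\<in>{0..t}. (\<integral>\<^sup>+\<omega>. ennreal (exp (- a * X (max s 0) \<omega>)) \<partial>M) * moment M X (a - 1) (t - s) \<partial>lborel)"
  proof (rule nn_integral_cong_AE)
    \<comment> \<open>The restarted path must run for a positive time t - s; the excluded point s =
      t is a null set.\<close>
    have "(\<integral>\<^sup>+\<omega>. G s \<omega> * indicator {0..t} s \<partial>M) =
      (\<integral>\<^sup>+\<omega>. ennreal (exp (- a * X (max s 0) \<omega>)) \<partial>M) * moment M X (a - 1) (t - s) * indicator {0..t} s"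
      if "s \<noteq> t" for s
    proof (cases "0 \<le> s \<and> s \<le> t")
      case True
      with that have s: "0 \<le> s" "s < t" "t - s > 0" by auto
      have "(\<integral>\<^sup>+\<omega>. G s \<omega> * indicator {0..t} s \<partial>M) =
          (\<integral>\<^sup>+\<omega>. ennreal (exp (- a * X s \<omega>)) * ennreal (pow_real (a - 1) (shifted_functional s (t - s) \<omega>)) \<partial>M)"
      proof (intro nn_integral_cong)
        fix \<omega> assume \<omega>: "\<omega> \<in> space M"
        let ?y = "exp (- X s \<omega>) * shifted_functional s (t - s) \<omega>"
        have "G s \<omega> * indicator {0..t} s = ennreal_powr (ennreal ?y) (a - 1) * ennreal (exp (- X s \<omega>))"
          unfolding G_def exp_functional_tail[OF \<omega> s(1,2)] using s by simp
        also have "ennreal_powr (ennreal ?y) (a - 1) = ennreal (pow_real (a - 1) ?y)"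
          by (rule ennreal_powr_ennreal) (simp add: shifted_functional_nonneg)
        also have "\<dots> * ennreal (exp (- X s \<omega>)) = ennreal (pow_real (a - 1) ?y * exp (- X s \<omega>))"
          by (rule ennreal_mult[symmetric]) (auto simp: pow_real_def)
        \<comment> \<open>The power contributes the factor \<open>exp (- X s \<omega>)\<close> to
          the exponent a - 1, and the derivative contributes one more. For a = 1 the power is 1 by
          convention, even at base 0.\<close>
        also have "pow_real (a - 1) (exp (- X s \<omega>) * shifted_functional s (t - s) \<omega>) * exp (- X s \<omega>) =
            exp (- a * X s \<omega>) * pow_real (a - 1) (shifted_functional s (t - s) \<omega>)"
        proof (cases "a = 1")
          case False
          have "exp (- X s \<omega>) powr (a - 1) * exp (- X s \<omega>) = exp (- a * X s \<omega>)"
            by (simp add: powr_def algebra_simps flip: exp_add)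
          then show ?thesis using False
            by (simp add: pow_real_def powr_mult shifted_functional_nonneg mult_ac)
        qed (simp add: pow_real_def)
        finally show "G s \<omega> * indicator {0..t} s =
            ennreal (exp (- a * X s \<omega>)) * ennreal (pow_real (a - 1) (shifted_functional s (t - s) \<omega>))"
          by (simp add: ennreal_mult pow_real_def)
      qed
      also have "\<dots> = (\<integral>\<^sup>+\<omega>. ennreal (exp (- a * X s \<omega>)) \<partial>M) * (\<integral>\<^sup>+\<omega>. ennreal (pow_real (a - 1) (shifted_functional 0 (t - s) \<omega>)) \<partial>M)"
        using s a by (intro shifted_functional_independent) auto
      also have "(\<integral>\<^sup>+\<omega>. ennreal (pow_real (a - 1) (shifted_functional 0 (t - s) \<omega>)) \<partial>M) = moment M X (a - 1) (t - s)"
        unfolding moment_def using s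
        by (intro nn_integral_cong) (simp add: exp_functional_eq_shifted ennreal_powr_ennreal shifted_functional_nonneg)
      finally show ?thesis using s by simp
    qed (auto simp: indicator_def)
    then show "AE s in lborel. (\<integral>\<^sup>+\<omega>. G s \<omega> * indicator {0..t} s \<partial>M) =
      (\<integral>\<^sup>+\<omega>. ennreal (exp (- a * X (max s 0) \<omega>)) \<partial>M) * moment M X (a - 1) (t - s) * indicator {0..t} s"
      using AE_lborel_singleton[of t] by (auto elim: eventually_mono)
  qed
  finally show ?thesis .
qed

text \<open>Tonelli on 0 \<le> s \<le> t and the substitution t = s + r split q exp(-q(s + r)) into
  exp(-qs) and q exp(-qr). The single factor q goes to the moment, which leaves a plain Laplace
  transform of the exponential moments.\<close>

lemma laplace_carson_moment:
  assumes a: "a \<ge> 1" and q: "q > 0"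
  shows "laplace_carson q (moment M X a) =
    ennreal a * (\<integral>\<^sup>+s\<in>{0..}. ennreal (exp (- q * s)) * (\<integral>\<^sup>+\<omega>. ennreal (exp (- a * X (max s 0) \<omega>)) \<partial>M) \<partial>lborel) *
      laplace_carson q (moment M X (a - 1))"
proof -
  define \<phi> where "\<phi> s = (\<integral>\<^sup>+\<omega>. ennreal (exp (- a * X (max s 0) \<omega>)) \<partial>M)" for s
  define m where "m = moment M X (a - 1)"
  have [measurable]: "m \<in> borel_measurable borel" by (simp add: m_def)
  have [measurable]: "\<phi> \<in> borel_measurable borel" unfolding \<phi>_def[abs_def] by measurable
  let ?E = "\<lambda>t. ennreal (q * exp (- q * t))"
  let ?F = "\<lambda>t s. ?E t * (\<phi> s * m (t - s) * indicator {w. 0 \<le> fst w \<and> fst w \<le> snd w} (s, t))"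
  have "laplace_carson q (moment M X a) = (\<integral>\<^sup>+t. ennreal a * (\<integral>\<^sup>+s. ?F t s \<partial>lborel) \<partial>lborel)"
    unfolding laplace_carson_def
  proof (intro nn_integral_cong)
    fix t :: real
    have "(\<integral>\<^sup>+s. ?F t s \<partial>lborel) = (\<integral>\<^sup>+s. ?E t * (\<phi> s * m (t - s) * indicator {0..t} s) \<partial>lborel)"
      by (intro nn_integral_cong) (simp add: indicator_def)
    also have "\<dots> = ?E t * (\<integral>\<^sup>+s\<in>{0..t}. \<phi> s * m (t - s) \<partial>lborel)"
      by (rule nn_integral_cmult) measurable
    finally have F: "ennreal a * (\<integral>\<^sup>+s. ?F t s \<partial>lborel) = ?E t * moment M X a t"
      unfolding moment_convolution[OF a] \<phi>_def m_def by (simp add: mult_ac)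
    show "?E t * moment M X a t * indicator {0..} t = ennreal a * (\<integral>\<^sup>+s. ?F t s \<partial>lborel)"
    proof (cases "t \<ge> 0")
      case False
      then have "?F t s = 0" for s by (simp add: indicator_def)
      then show ?thesis using False by simp
    next
      case True
      then show ?thesis unfolding F by simp
    qed
  qed
  also have "\<dots> = ennreal a * (\<integral>\<^sup>+t. (\<integral>\<^sup>+s. ?F t s \<partial>lborel) \<partial>lborel)"
    by (rule nn_integral_cmult) measurable
  also have "(\<integral>\<^sup>+t. (\<integral>\<^sup>+s. ?F t s \<partial>lborel) \<partial>lborel) = (\<integral>\<^sup>+s. (\<integral>\<^sup>+t. ?F t s \<partial>lborel) \<partial>lborel)"
    by (rule lborel_pair.Fubini') measurable
  also have "\<dots> = (\<integral>\<^sup>+s. (ennreal (exp (- q * s)) * \<phi> s * indicator {0..} s) * laplace_carson q m \<partial>lborel)"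
  proof (intro nn_integral_cong)
    fix s :: real
    have "(\<integral>\<^sup>+t. ?F t s \<partial>lborel) = (\<integral>\<^sup>+r. ?F (s + r) s \<partial>lborel)"
      using nn_integral_real_affine[of "\<lambda>t. ?F t s" 1 s] by simp
    also have "\<dots> = (\<integral>\<^sup>+r. (ennreal (exp (- q * s)) * \<phi> s * indicator {0..} s) * (?E r * m r * indicator {0..} r) \<partial>lborel)"
    proof (intro nn_integral_cong)
      fix r :: real
      have "?E (s + r) = ennreal (exp (- q * s)) * ?E r"
      proof -
        have "q * exp (- q * (s + r)) = exp (- q * s) * (q * exp (- q * r))"
          by (simp add: distrib_left exp_diff exp_minus divide_inverse)
        then show ?thesis using q by (simp add: ennreal_mult mult_ac)
      qed
      then show "?F (s + r) s = (ennreal (exp (- q * s)) * \<phi> s * indicator {0..} s) * (?E r * m r * indicator {0..} r)"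
        by (auto simp: indicator_def mult_ac)
    qed
    also have "\<dots> = (ennreal (exp (- q * s)) * \<phi> s * indicator {0..} s) * laplace_carson q m"
      unfolding laplace_carson_def by (rule nn_integral_cmult) measurable
    finally show "(\<integral>\<^sup>+t. ?F t s \<partial>lborel) = \<dots>" .
  qed
  also have "\<dots> = (\<integral>\<^sup>+s\<in>{0..}. ennreal (exp (- q * s)) * \<phi> s \<partial>lborel) * laplace_carson q m"
    by (rule nn_integral_multc) measurable
  finally show ?thesis by (simp add: \<phi>_def m_def mult.assoc)
qed

end

section \<open>Laplace-Carson transforms and limits\<close>

lemma nn_integral_exp_scaled:
  assumes q: "q > 0"
  shows "(\<integral>\<^sup>+t\<in>{0..}. ennreal (q * exp (- q * t)) \<partial>lborel) = 1"
proof -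
  interpret prob_space "density lborel (\<lambda>x. ennreal (exponential_density q x))"
    using q by (rule prob_space_exponential_density)
  have "(\<integral>\<^sup>+t\<in>{0..}. ennreal (q * exp (- q * t)) \<partial>lborel) = (\<integral>\<^sup>+t. ennreal (exponential_density q t) \<partial>lborel)"
    by (intro nn_integral_cong) (auto simp: exponential_density_def indicator_def mult.commute)
  also have "\<dots> = 1"
    using emeasure_space_1 by (subst (asm) emeasure_density) auto
  finally show ?thesis .
qed

lemma laplace_carson_const: "q > 0 \<Longrightarrow> laplace_carson q (\<lambda>_. c) = c"
proof -
  assume q: "q > 0"
  have "laplace_carson q (\<lambda>_. c) = (\<integral>\<^sup>+t. (ennreal (q * exp (- q * t)) * indicator {0..} t) * c \<partial>lborel)"
    unfolding laplace_carson_def by (intro nn_integral_cong) (simp add: mult_ac)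
  also have "\<dots> = (\<integral>\<^sup>+t\<in>{0..}. ennreal (q * exp (- q * t)) \<partial>lborel) * c"
    by (rule nn_integral_multc) measurable
  finally show ?thesis using nn_integral_exp_scaled[OF q] by simp
qed

lemma laplace_carson_mono: "(\<And>t. t \<ge> 0 \<Longrightarrow> f t \<le> g t) \<Longrightarrow> laplace_carson q f \<le> laplace_carson q g"
  unfolding laplace_carson_def by (intro nn_integral_mono) (auto simp: indicator_def intro!: mult_left_mono)

text \<open>\<open>exp (- q * T)\<close> is the mass that the exponential law of rate q gives to
  {T..}, where f is at least c.\<close>

lemma laplace_carson_ge:
  assumes q: "q > 0" and "T \<ge> 0" and f: "\<And>t. t \<ge> T \<Longrightarrow> c \<le> f t"
  shows "ennreal (exp (- q * T)) * c \<le> laplace_carson q f"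
proof -
  let ?E = "\<lambda>t. ennreal (q * exp (- q * t))"
  have "ennreal (exp (- q * T)) * c = ennreal (exp (- q * T)) * laplace_carson q (\<lambda>_. c)"
    using q by (simp add: laplace_carson_const)
  also have "\<dots> = (\<integral>\<^sup>+t. ennreal (exp (- q * T)) * (?E t * c * indicator {0..} t) \<partial>lborel)"
    unfolding laplace_carson_def by (rule nn_integral_cmult[symmetric]) measurable
  also have "\<dots> = (\<integral>\<^sup>+t. ?E (T + t) * c * indicator {T..} (T + t) \<partial>lborel)"
  proof (intro nn_integral_cong)
    fix t :: real
    have "q * exp (- q * (T + t)) = exp (- q * T) * (q * exp (- q * t))"
      by (simp add: distrib_left exp_diff exp_minus divide_inverse)
    then have "?E (T + t) = ennreal (exp (- q * T)) * ?E t" using q by (simp add: ennreal_mult mult_ac)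
    then show "ennreal (exp (- q * T)) * (?E t * c * indicator {0..} t) = ?E (T + t) * c * indicator {T..} (T + t)"
      by (simp add: indicator_def mult_ac)
  qed
  also have "\<dots> = (\<integral>\<^sup>+t. ?E t * c * indicator {T..} t \<partial>lborel)"
    using nn_integral_real_affine[of "\<lambda>t. ?E t * c * indicator {T..} t" 1 T] by simp
  also have "\<dots> \<le> laplace_carson q f"
    unfolding laplace_carson_def using f \<open>T \<ge> 0\<close>
    by (intro nn_integral_mono) (auto simp: indicator_def intro!: mult_left_mono)
  finally show ?thesis .
qed

text \<open>The sign of c is a conclusion: for c \<le> 0 the integrand is at least 1 on a set of
  infinite measure. This is the source of q + \<Phi>(\<alpha>) > 0.\<close>

lemma nn_integral_exp_half_line:
  assumes "(\<integral>\<^sup>+t\<in>{0..}. ennreal (exp (- c * t)) \<partial>lborel) < \<infinity>"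
  shows "c > 0" "(\<integral>\<^sup>+t\<in>{0..}. ennreal (exp (- c * t)) \<partial>lborel) = ennreal (1 / c)"
proof -
  show c: "c > 0"
  proof (rule ccontr)
    assume "\<not> c > 0"
    then have "1 \<le> ennreal (exp (- c * t))" if "t \<ge> 0" for t
      using that ennreal_leI[of 1 "exp (- c * t)"] by (simp add: mult_nonpos_nonneg)
    then have le: "indicator {0..} t \<le> ennreal (exp (- c * t)) * indicator {0..} t" for t :: real
      by (simp add: indicator_def)
    have "(\<integral>\<^sup>+t. indicator {0::real..} t \<partial>lborel) \<le> (\<integral>\<^sup>+t\<in>{0..}. ennreal (exp (- c * t)) \<partial>lborel)"
      by (rule nn_integral_mono) (rule le)
    moreover have "(\<integral>\<^sup>+t. indicator {0::real..} t \<partial>lborel) = (\<infinity> :: ennreal)"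
    proof -
      have "ennreal (real n) \<le> emeasure lborel {0::real..}" for n :: nat
        using emeasure_mono[of "{0..real n}" "{0..}" lborel] by simp
      then have "emeasure lborel {0::real..} = \<infinity>"
        by (metis ennreal_SUP_of_nat_eq_top ennreal_of_nat_eq_real_of_nat SUP_least infinity_ennreal_def top_unique)
      then show ?thesis by simp
    qed
    ultimately show False using assms by simp
  qed
  have "1 = (\<integral>\<^sup>+t. ennreal c * (ennreal (exp (- c * t)) * indicator {0..} t) \<partial>lborel)"
    using c by (subst nn_integral_exp_scaled[OF c, symmetric]) (auto intro!: nn_integral_cong simp: ennreal_mult mult_ac)
  also have "\<dots> = ennreal c * (\<integral>\<^sup>+t\<in>{0..}. ennreal (exp (- c * t)) \<partial>lborel)"
    by (rule nn_integral_cmult) measurable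
  finally have 1: "ennreal c * (\<integral>\<^sup>+t\<in>{0..}. ennreal (exp (- c * t)) \<partial>lborel) = 1" by simp
  have "ennreal (1 / c) * ennreal c = 1" using c by (simp flip: ennreal_mult)
  then have "(\<integral>\<^sup>+t\<in>{0..}. ennreal (exp (- c * t)) \<partial>lborel) =
      ennreal (1 / c) * (ennreal c * (\<integral>\<^sup>+t\<in>{0..}. ennreal (exp (- c * t)) \<partial>lborel))"
    by (simp add: mult.assoc[symmetric])
  then show "(\<integral>\<^sup>+t\<in>{0..}. ennreal (exp (- c * t)) \<partial>lborel) = ennreal (1 / c)" unfolding 1 by simp
qed

text \<open>Below 1 the left side is at most 1, above 1 powers increase with the exponent. On a
  probability space lower moments thus inherit finiteness.\<close>

lemma ennreal_powr_le_add:
  assumes "0 \<le> b" "b \<le> a"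
  shows "ennreal_powr x b \<le> 1 + ennreal_powr x a"
proof (cases x)
  case (real y)
  have "pow_real b y \<le> 1 + pow_real a y"
  proof (cases "y \<le> 1")
    case True
    then have "pow_real b y \<le> 1" using real assms by (auto simp: pow_real_def intro: powr_le1)
    moreover have "pow_real a y \<ge> 0" by (simp add: pow_real_def)
    ultimately show ?thesis by linarith
  next
    case False
    then have "y powr b \<le> y powr a" using assms by (intro powr_mono) auto
    then have "y powr b \<le> 1 + y powr a" by linarith
    then show ?thesis using assms False by (auto simp: pow_real_def)
  qed
  then have "ennreal (pow_real b y) \<le> ennreal (1 + pow_real a y)" by (rule ennreal_leI)
  also have "\<dots> = 1 + ennreal (pow_real a y)" by (simp add: pow_real_def)
  finally show ?thesis using real by (simp add: ennreal_powr_ennreal)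
next
  case top
  then show ?thesis using assms by (auto simp: ennreal_powr_def)
qed

section \<open>Positivity of moments and passage to the infinite horizon\<close>

context levy_process begin

lemma moment_0: "moment M X 0 t = 1" and moment_inf_0: "moment_inf M X 0 = 1"
  by (simp_all add: moment_def moment_inf_def ennreal_powr_def emeasure_space_1)

lemma exp_functional_mono: "s \<le> t \<Longrightarrow> exp_functional X s \<omega> \<le> exp_functional X t \<omega>"
  unfolding exp_functional_def by (intro nn_integral_mono) (auto simp: indicator_def)

lemma exp_functional_le_inf: "exp_functional X t \<omega> \<le> exp_functional_inf X \<omega>"
  unfolding exp_functional_def exp_functional_inf_def by (intro nn_integral_mono) (auto simp: indicator_def)

lemma moment_mono: "a \<ge> 0 \<Longrightarrow> s \<le> t \<Longrightarrow> moment M X a s \<le> moment M X a t"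
  unfolding moment_def by (intro nn_integral_mono ennreal_powr_mono exp_functional_mono)

lemma moment_le_inf: "a \<ge> 0 \<Longrightarrow> moment M X a t \<le> moment_inf M X a"
  unfolding moment_def moment_inf_def by (intro nn_integral_mono ennreal_powr_mono exp_functional_le_inf)

lemma laplace_carson_le_inf: "a \<ge> 0 \<Longrightarrow> q > 0 \<Longrightarrow> laplace_carson q (moment M X a) \<le> moment_inf M X a"
  using laplace_carson_mono[of "moment M X a" "\<lambda>_. moment_inf M X a" q] moment_le_inf[of a]
  by (simp add: laplace_carson_const)

lemma moment_inf_finite_mono:
  assumes "0 \<le> b" "b \<le> a" "moment_inf M X a < \<infinity>"
  shows "moment_inf M X b < \<infinity>"
proof -
  have meas: "(\<lambda>\<omega>. ennreal_powr (exp_functional_inf X \<omega>) a) \<in> borel_measurable M" by measurable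
  have "moment_inf M X b \<le> (\<integral>\<^sup>+\<omega>. 1 + ennreal_powr (exp_functional_inf X \<omega>) a \<partial>M)"
    unfolding moment_inf_def using assms by (intro nn_integral_mono ennreal_powr_le_add)
  also have "\<dots> = 1 + moment_inf M X a"
    unfolding moment_inf_def using meas by (subst nn_integral_add) (auto simp: emeasure_space_1)
  finally show ?thesis using assms by (auto simp: ennreal_add_eq_top less_top[symmetric] top_unique)
qed

lemma exp_functional_pos:
  assumes \<omega>: "\<omega> \<in> space M" and "t > 0"
  shows "exp_functional X t \<omega> > 0"
proof (rule ccontr)
  note [measurable] = measurable_path[OF \<omega>]
  assume "\<not> exp_functional X t \<omega> > 0"
  then have "(\<integral>\<^sup>+u\<in>{0..t}. ennreal (exp (- X (max u 0) \<omega>)) \<partial>lborel) = 0"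
    by (simp add: exp_functional_eq)
  then have "AE u in lborel. ennreal (exp (- X (max u 0) \<omega>)) * indicator {0..t} u = 0"
    by (subst (asm) nn_integral_0_iff_AE) measurable
  then have "AE u in lborel. u \<notin> {0..t}" by eventually_elim (auto simp: indicator_def)
  then have "emeasure lborel {0..t} = 0" by (subst (asm) AE_iff_measurable[where N="{0..t}"]) auto
  then show False using \<open>t > 0\<close> by simp
qed

text \<open>Every path has a strictly positive integral. This is used to cancel: in [0, \<infinity>]
  a finite product controls one factor only if the other is not 0.\<close>

lemma moment_pos:
  assumes "t > 0"
  shows "moment M X a t > 0"
proof (rule ccontr)
  assume "\<not> moment M X a t > 0"
  then have "(\<integral>\<^sup>+\<omega>. ennreal_powr (exp_functional X t \<omega>) a \<partial>M) = 0" by (simp add: moment_def)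
  then have "AE \<omega> in M. ennreal_powr (exp_functional X t \<omega>) a = 0"
    by (subst (asm) nn_integral_0_iff_AE) measurable
  then have "AE \<omega> in M. False"
    using AE_space
  proof eventually_elim
    case (elim \<omega>)
    have "shifted_functional 0 t \<omega> > 0"
      using exp_functional_pos[OF elim(2) assms] exp_functional_eq_shifted[OF elim(2) assms]
        shifted_functional_nonneg[of 0 t \<omega>] by (simp add: order_less_le)
    then show False using elim(1) exp_functional_eq_shifted[OF elim(2) assms]
      by (simp add: ennreal_powr_ennreal shifted_functional_nonneg pow_real_def split: if_splits)
  qed
  then show False using AE_False emeasure_space_1 by simp
qed

lemma moment_inf_pos: "a \<ge> 0 \<Longrightarrow> moment_inf M X a > 0"
  using moment_pos[of 1 a] moment_le_inf[of a 1] by (rule less_le_trans) simp_all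

lemma laplace_carson_moment_pos:
  assumes "a \<ge> 0" "q > 0"
  shows "laplace_carson q (moment M X a) > 0"
proof -
  have "ennreal (exp (- q * 1)) * moment M X a 1 \<le> laplace_carson q (moment M X a)"
    using assms by (intro laplace_carson_ge moment_mono) auto
  moreover have "0 < ennreal (exp (- q * 1)) * moment M X a 1"
    using moment_pos[of 1 a] by (simp add: ennreal_zero_less_mult_iff)
  ultimately show ?thesis by (rule less_le_trans[rotated])
qed

text \<open>For a > 0 a finite moment makes the functional over the half-line finite almost surely,
  and at finite values the power is continuous. The limit itself dominates the sequence.\<close>

lemma moment_tendsto_inf:
  assumes a: "a \<ge> 0" and fin: "moment_inf M X a < \<infinity>"
  shows "(\<lambda>n. moment M X a (real n)) \<longlonglongrightarrow> moment_inf M X a"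
proof (cases "a = 0")
  case False
  then have a: "a > 0" using a by simp
  have "AE \<omega> in M. ennreal_powr (exp_functional_inf X \<omega>) a \<noteq> \<infinity>"
    using fin unfolding moment_inf_def by (intro nn_integral_PInf_AE) auto
  then have "AE \<omega> in M. (\<lambda>n. ennreal_powr (exp_functional X (real n) \<omega>) a) \<longlonglongrightarrow> ennreal_powr (exp_functional_inf X \<omega>) a"
    using AE_space
  proof eventually_elim
    case (elim \<omega>)
    note [measurable] = measurable_path[OF elim(2)]
    have finI: "exp_functional_inf X \<omega> < \<infinity>"
      using elim(1) False by (auto simp: ennreal_powr_def less_top[symmetric] split: if_splits)
    have "(\<lambda>n. exp_functional X (real n) \<omega>) \<longlonglongrightarrow> exp_functional_inf X \<omega>"
      unfolding exp_functional_eq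
    proof (rule nn_integral_LIMSEQ)
      show "incseq (\<lambda>n u. ennreal (exp (- X (max u 0) \<omega>)) * indicator {0..real n} u)"
        by (auto simp: incseq_def le_fun_def indicator_def)
      fix u :: real
      obtain N where "u \<le> real N" using real_arch_simple by blast
      then have "\<forall>\<^sub>F n in sequentially. ennreal (exp (- X (max u 0) \<omega>)) * indicator {0..real n} u =
          ennreal (exp (- X (max u 0) \<omega>)) * indicator {0..} u"
        by (auto simp: eventually_sequentially indicator_def intro!: exI[of _ N])
      then show "(\<lambda>n. ennreal (exp (- X (max u 0) \<omega>)) * indicator {0..real n} u) \<longlonglongrightarrow>
          ennreal (exp (- X (max u 0) \<omega>)) * indicator {0..} u"
        by (rule tendsto_eventually)
    qed measurable
    moreover have eqI: "exp_functional_inf X \<omega> = ennreal (enn2real (exp_functional_inf X \<omega>))"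
      using finI by simp
    ultimately have "(\<lambda>n. enn2real (exp_functional X (real n) \<omega>)) \<longlonglongrightarrow> enn2real (exp_functional_inf X \<omega>)"
      by (intro tendsto_enn2real) auto
    then have "(\<lambda>n. enn2real (exp_functional X (real n) \<omega>) powr a) \<longlonglongrightarrow> enn2real (exp_functional_inf X \<omega>) powr a"
      using a by (intro tendsto_powr') auto
    moreover have "exp_functional X (real n) \<omega> \<noteq> \<infinity>" for n
      using exp_functional_le_inf[of "real n" \<omega>] finI by (auto simp: top_unique)
    ultimately show ?case
      using finI False by (auto simp: ennreal_powr_def intro!: tendsto_ennrealI)
  qed
  moreover have "AE \<omega> in M. ennreal_powr (exp_functional X (real n) \<omega>) a \<le> ennreal_powr (exp_functional_inf X \<omega>) a" for n
    using a by (auto intro!: ennreal_powr_mono exp_functional_le_inf)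
  ultimately show ?thesis
    using fin unfolding moment_def moment_inf_def
    by (intro nn_integral_dominated_convergence[where w="\<lambda>\<omega>. ennreal_powr (exp_functional_inf X \<omega>) a"]) auto
qed (simp add: moment_0 moment_inf_0)

text \<open>An Abelian squeeze: the transform is an average over an exponential time, hence at most
  the limit moment; keeping only times after n bounds it below by \<open>exp (- q * n)\<close> times
  the moment at n, which loses nothing as q tends to 0.\<close>

lemma laplace_carson_tendsto_inf:
  assumes a: "a \<ge> 0" and fin: "moment_inf M X a < \<infinity>"
  shows "((\<lambda>q. enn2real (laplace_carson q (moment M X a))) \<longlongrightarrow> enn2real (moment_inf M X a)) (at_right 0)"
proof (rule tendsto_enn2real)
  have pos: "\<forall>\<^sub>F q in at_right 0. (q::real) > 0" by (rule eventually_at_right_less)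
  have "((\<lambda>q. laplace_carson q (moment M X a)) \<longlongrightarrow> moment_inf M X a) (at_right 0)"
  proof (rule order_tendstoI)
    fix c assume "moment_inf M X a < c"
    then show "\<forall>\<^sub>F q in at_right 0. laplace_carson q (moment M X a) < c"
      using pos by (auto elim!: eventually_mono intro: le_less_trans laplace_carson_le_inf[OF a])
  next
    fix c assume "c < moment_inf M X a"
    from order_tendstoD(1)[OF moment_tendsto_inf[OF a fin] this]
    obtain n where n: "c < moment M X a (real n)" by (auto simp: eventually_sequentially)
    have "((\<lambda>q. ennreal (exp (- q * real n)) * moment M X a (real n)) \<longlongrightarrow> ennreal (exp (- 0 * real n)) * moment M X a (real n)) (at_right 0)"
    proof (rule tendsto_mult_ennreal)
      show "((\<lambda>q. ennreal (exp (- q * real n))) \<longlongrightarrow> ennreal (exp (- 0 * real n))) (at_right 0)"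
        by (intro tendsto_intros)
    qed (use moment_le_inf[OF a, of "real n"] fin in \<open>auto simp: top_unique\<close>)
    with n have "\<forall>\<^sub>F q in at_right 0. c < ennreal (exp (- q * real n)) * moment M X a (real n)"
      by (intro order_tendstoD(1)) auto
    with pos show "\<forall>\<^sub>F q in at_right 0. c < laplace_carson q (moment M X a)"
    proof eventually_elim
      case (elim q)
      have "ennreal (exp (- q * real n)) * moment M X a (real n) \<le> laplace_carson q (moment M X a)"
        using elim a by (intro laplace_carson_ge moment_mono) auto
      with elim show ?case by (simp add: less_le_trans)
    qed
  qed
  then show "((\<lambda>q. laplace_carson q (moment M X a)) \<longlongrightarrow> ennreal (enn2real (moment_inf M X a))) (at_right 0)"
    using fin by simp
qed simp

end

section \<open>Recursion in the exponent, integer moments and Laplace transform\<close>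

lemma exp_tail_integral_mono:
  fixes \<alpha> \<beta> :: real
  assumes "\<beta> \<le> \<alpha>"
  shows "(\<integral>\<^sup>+x\<in>{..<-1}. ennreal (exp (- \<beta> * x)) \<partial>K) \<le> (\<integral>\<^sup>+x\<in>{..<-1}. ennreal (exp (- \<alpha> * x)) \<partial>K)"
proof (rule nn_integral_mono)
  fix x
  have "- \<beta> * x \<le> - \<alpha> * x" if "x < -1"
    by (rule mult_right_mono_neg) (use that assms in auto)
  then show "ennreal (exp (- \<beta> * x)) * indicator {..<-1} x \<le> ennreal (exp (- \<alpha> * x)) * indicator {..<-1} x"
    by (auto simp: indicator_def intro!: ennreal_leI)
qed

lemma exp_tail_condition_mono:
  assumes "exp_tail_condition K \<alpha>" "\<beta> \<le> \<alpha>"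
  shows "exp_tail_condition K \<beta>"
  using assms(1) exp_tail_integral_mono[of "\<beta> + _" "\<alpha> + _" K] assms(2)
  unfolding exp_tail_condition_def by (meson add_right_mono le_less_trans)

lemma exp_tail_condition_finite:
  assumes "exp_tail_condition K \<alpha>"
  shows "(\<integral>\<^sup>+x\<in>{..<-1}. ennreal (exp (- \<alpha> * x)) \<partial>K) < \<infinity>"
proof -
  obtain \<delta> where "\<delta> > 0" "(\<integral>\<^sup>+x\<in>{..<-1}. ennreal (exp (- (\<alpha> + \<delta>) * x)) \<partial>K) < \<infinity>"
    using assms unfolding exp_tail_condition_def by blast
  then show ?thesis using exp_tail_integral_mono[of \<alpha> "\<alpha> + \<delta>" K] by (simp add: le_less_trans)
qed

text \<open>The Lagrange remainder is a positive multiple of \<open>(- x) ^ n\<close>, whose sign is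
  governed by the parity of n.\<close>

lemma exp_alternating_bounds:
  fixes x :: real
  assumes "x \<ge> 0"
  shows "even n \<Longrightarrow> (\<Sum>m<n. (- x) ^ m / fact m) \<le> exp (- x)"
    and "odd n \<Longrightarrow> exp (- x) \<le> (\<Sum>m<n. (- x) ^ m / fact m)"
proof -
  obtain t where t: "exp (- x) = (\<Sum>m<n. (- x) ^ m / fact m) + exp t / fact n * (- x) ^ n"
    using Maclaurin_exp_le[of "- x" n] by blast
  show "(\<Sum>m<n. (- x) ^ m / fact m) \<le> exp (- x)" if "even n"
    using that assms unfolding t by simp
  show "exp (- x) \<le> (\<Sum>m<n. (- x) ^ m / fact m)" if "odd n"
    using that assms unfolding t by (simp add: mult_nonneg_nonpos)
qed

locale levy_process_finite_mean = levy_process_params +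
  assumes finite_mean: "(\<integral>\<^sup>+x\<in>-{0}. ennreal (min (x\<^sup>2) \<bar>x\<bar>) \<partial>K\<^sub>0) < \<infinity>"
begin

definition levy_exponent :: "real \<Rightarrow> real" where
  "levy_exponent = laplace_exponent b\<^sub>0 c\<^sub>0 K\<^sub>0"

lemma exponential_moment:
  assumes \<alpha>: "\<alpha> > 0" and tail: "exp_tail_condition K\<^sub>0 \<alpha>" and s: "s \<ge> 0"
    and fin: "(\<integral>\<^sup>+\<omega>. ennreal (exp (- \<alpha> * X s \<omega>)) \<partial>M) < \<infinity>"
  shows "(\<integral>\<^sup>+\<omega>. ennreal (exp (- \<alpha> * X s \<omega>)) \<partial>M) = ennreal (exp (- s * levy_exponent \<alpha>))"
proof -
  note X [measurable] = measurable_X[OF s]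
  have int: "integrable M (\<lambda>\<omega>. exp (- \<alpha> * X s \<omega>))"
    using fin by (intro integrableI_bounded) auto
  have "(\<integral>x. exp (- \<alpha> * x) \<partial>(distr M borel (X s))) = exp (- s * laplace_exponent b\<^sub>0 c\<^sub>0 K\<^sub>0 \<alpha>)"
  proof (rule exponential_moment_levy_khintchine)
    show "real_distribution (distr M borel (X s))" using X by (rule real_distribution_distr)
    show "integrable (distr M borel (X s)) (\<lambda>x. exp (- \<alpha> * x))"
      using int by (subst integrable_distr_eq) auto
    show "sets K\<^sub>0 = sets borel" using levy_measure by (simp add: levy_measure_def)
  qed (use \<alpha> finite_mean exp_tail_condition_finite[OF tail] khintchine[OF s] in auto)
  then have "expectation (\<lambda>\<omega>. exp (- \<alpha> * X s \<omega>)) = exp (- s * levy_exponent \<alpha>)"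
    by (simp add: integral_distr levy_exponent_def)
  then show ?thesis using nn_integral_eq_integral[OF int] by simp
qed

text \<open>
  Finiteness of the exponential moments of \<open>X\<close> is not assumed: the convolution formula turns finiteness
  of \<open>moment_inf M X \<alpha>\<close> into finiteness of the resolvent \<open>R\<close>, hence of \<open>E (exp (- \<alpha> X\<^sub>s))\<close> for a.e. \<open>s\<close>.
\<close>

lemma laplace_carson_recursion:
  assumes \<alpha>: "\<alpha> \<ge> 1" and tail: "exp_tail_condition K\<^sub>0 \<alpha>" and fin: "moment_inf M X \<alpha> < \<infinity>" and q: "q > 0"
  shows "laplace_carson q (moment M X \<alpha>) < \<infinity>" "laplace_carson q (moment M X (\<alpha> - 1)) < \<infinity>"
    and "q + levy_exponent \<alpha> > 0"
    and "enn2real (laplace_carson q (moment M X \<alpha>)) * (q + levy_exponent \<alpha>) = \<alpha> * enn2real (laplace_carson q (moment M X (\<alpha> - 1)))"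
proof -
  let ?L = "laplace_carson q (moment M X \<alpha>)" and ?L' = "laplace_carson q (moment M X (\<alpha> - 1))"
  define \<phi> where "\<phi> s = (\<integral>\<^sup>+\<omega>. ennreal (exp (- \<alpha> * X (max s 0) \<omega>)) \<partial>M)" for s
  define R where "R = (\<integral>\<^sup>+s\<in>{0..}. ennreal (exp (- q * s)) * \<phi> s \<partial>lborel)"
  have [measurable]: "\<phi> \<in> borel_measurable borel" unfolding \<phi>_def[abs_def] by measurable
  have conv: "?L = ennreal \<alpha> * R * ?L'"
    unfolding R_def \<phi>_def using \<alpha> q by (rule laplace_carson_moment)
  show L: "?L < \<infinity>"
    using laplace_carson_le_inf[of \<alpha> q] \<alpha> q fin by (simp add: le_less_trans)
  have "moment_inf M X (\<alpha> - 1) < \<infinity>"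
    using \<alpha> fin by (intro moment_inf_finite_mono[of "\<alpha> - 1" \<alpha>]) auto
  then show L': "?L' < \<infinity>"
    using laplace_carson_le_inf[of "\<alpha> - 1" q] \<alpha> q by (simp add: le_less_trans)
  \<comment> \<open>Without this a zero factor could hide an infinite R, since 0 times \<infinity>
    is 0.\<close>
  have "?L' > 0" using \<alpha> q by (intro laplace_carson_moment_pos) auto
  then have R: "R < \<infinity>"
    using L \<alpha> unfolding conv by (auto simp: ennreal_mult_eq_top_iff less_top[symmetric])
  have "AE s in lborel. ennreal (exp (- q * s)) * \<phi> s * indicator {0..} s \<noteq> \<infinity>"
    using R unfolding R_def by (intro nn_integral_PInf_AE) auto
  then have "AE s in lborel. ennreal (exp (- q * s)) * \<phi> s * indicator {0..} s = ennreal (exp (- (q + levy_exponent \<alpha>) * s)) * indicator {0..} s"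
  proof eventually_elim
    case (elim s)
    show ?case
    proof (cases "s \<ge> 0")
      case True
      with elim have "\<phi> s < \<infinity>" by (auto simp: ennreal_mult_eq_top_iff less_top[symmetric])
      with True have "\<phi> s = ennreal (exp (- s * levy_exponent \<alpha>))"
        using exponential_moment[OF _ tail True] \<alpha> by (simp add: \<phi>_def max_absorb1)
      then show ?thesis by (simp add: algebra_simps exp_diff exp_minus divide_inverse flip: ennreal_mult)
    qed (simp add: indicator_def)
  qed
  then have "R = (\<integral>\<^sup>+s\<in>{0..}. ennreal (exp (- (q + levy_exponent \<alpha>) * s)) \<partial>lborel)"
    unfolding R_def by (rule nn_integral_cong_AE)
  with R nn_integral_exp_half_line[of "q + levy_exponent \<alpha>"] have pos: "q + levy_exponent \<alpha> > 0" "R = ennreal (1 / (q + levy_exponent \<alpha>))"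
    by auto
  then show "q + levy_exponent \<alpha> > 0" by simp
  have "enn2real ?L = \<alpha> * (1 / (q + levy_exponent \<alpha>)) * enn2real ?L'"
    unfolding conv pos(2) using \<alpha> pos(1) by (simp add: enn2real_mult)
  then show "enn2real ?L * (q + levy_exponent \<alpha>) = \<alpha> * enn2real ?L'"
    using pos(1) by simp
qed

text \<open>The limit q \<rightarrow> 0 is taken in the undivided recursion, because the limit of q
  + \<Phi>(\<alpha>) might a priori be 0.\<close>

lemma moment_inf_recursion:
  assumes \<alpha>: "\<alpha> \<ge> 1" and tail: "exp_tail_condition K\<^sub>0 \<alpha>" and fin: "moment_inf M X \<alpha> < \<infinity>"
  shows "enn2real (moment_inf M X \<alpha>) * levy_exponent \<alpha> = \<alpha> * enn2real (moment_inf M X (\<alpha> - 1))"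
proof (rule tendsto_unique)
  let ?L = "\<lambda>\<alpha> q. enn2real (laplace_carson q (moment M X \<alpha>))"
  have fin': "moment_inf M X (\<alpha> - 1) < \<infinity>"
    using \<alpha> fin by (intro moment_inf_finite_mono[of "\<alpha> - 1" \<alpha>]) auto
  show "((\<lambda>q. \<alpha> * ?L (\<alpha> - 1) q) \<longlongrightarrow> \<alpha> * enn2real (moment_inf M X (\<alpha> - 1))) (at_right 0)"
    using \<alpha> fin' by (intro tendsto_intros laplace_carson_tendsto_inf) auto
  have "((\<lambda>q. ?L \<alpha> q * (q + levy_exponent \<alpha>)) \<longlongrightarrow> enn2real (moment_inf M X \<alpha>) * (0 + levy_exponent \<alpha>)) (at_right 0)"
    using \<alpha> fin by (intro tendsto_intros laplace_carson_tendsto_inf) auto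
  moreover have "\<forall>\<^sub>F q in at_right 0. ?L \<alpha> q * (q + levy_exponent \<alpha>) = \<alpha> * ?L (\<alpha> - 1) q"
    using eventually_at_right_less[of "0::real"]
    by eventually_elim (rule laplace_carson_recursion(4)[OF \<alpha> tail fin])
  ultimately show "((\<lambda>q. \<alpha> * ?L (\<alpha> - 1) q) \<longlongrightarrow> enn2real (moment_inf M X \<alpha>) * levy_exponent \<alpha>) (at_right 0)"
    by (auto intro: Lim_transform_eventually)
qed simp

lemma integer_moments:
  assumes "exp_tail_condition K\<^sub>0 (real n)" "moment_inf M X (real n) < \<infinity>"
  shows "q > 0 \<Longrightarrow> enn2real (laplace_carson q (moment M X (real n))) = fact n / (\<Prod>k=1..n. q + levy_exponent (real k))"
    and "enn2real (moment_inf M X (real n)) = fact n / (\<Prod>k=1..n. levy_exponent (real k))"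
proof -
  have "(q > 0 \<longrightarrow> enn2real (laplace_carson q (moment M X (real n))) = fact n / (\<Prod>k=1..n. q + levy_exponent (real k))) \<and>
     enn2real (moment_inf M X (real n)) = fact n / (\<Prod>k=1..n. levy_exponent (real k))"
    using assms
  proof (induction n)
    case 0
    then show ?case by (simp add: moment_inf_0 moment_0[abs_def] laplace_carson_const)
  next
    case (Suc n)
    have tail: "exp_tail_condition K\<^sub>0 (real n)"
      using Suc.prems(1) by (rule exp_tail_condition_mono) simp
    have fin: "moment_inf M X (real n) < \<infinity>"
      using Suc.prems(2) by (intro moment_inf_finite_mono[of "real n" "real (Suc n)"]) auto
    note IH = Suc.IH[OF tail fin]
    have pred: "real (Suc n) - 1 = real n" by simp
    have "enn2real (laplace_carson q (moment M X (real (Suc n)))) = fact (Suc n) / (\<Prod>k=1..Suc n. q + levy_exponent (real k))"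
      if q: "q > 0"
    proof -
      have "enn2real (laplace_carson q (moment M X (real (Suc n)))) * (q + levy_exponent (real (Suc n))) =
          real (Suc n) * (fact n / (\<Prod>k=1..n. q + levy_exponent (real k)))"
        using laplace_carson_recursion(4)[OF _ Suc.prems q] IH q unfolding pred by simp
      moreover have "q + levy_exponent (real (Suc n)) > 0" using laplace_carson_recursion(3)[OF _ Suc.prems q] by simp
      ultimately have "enn2real (laplace_carson q (moment M X (real (Suc n)))) =
          real (Suc n) * (fact n / (\<Prod>k=1..n. q + levy_exponent (real k))) / (q + levy_exponent (real (Suc n)))"
        by (intro eq_divide_imp) simp_all
      then show ?thesis by (simp add: prod.nat_ivl_Suc')
    qed
    moreover have "enn2real (moment_inf M X (real (Suc n))) = fact (Suc n) / (\<Prod>k=1..Suc n. levy_exponent (real k))"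
    proof -
      have rec: "enn2real (moment_inf M X (real (Suc n))) * levy_exponent (real (Suc n)) =
          real (Suc n) * enn2real (moment_inf M X (real n))"
        using moment_inf_recursion[OF _ Suc.prems] unfolding pred by simp
      \<comment> \<open>A positive right-hand side in the recursion rules out that the exponent
        vanishes at n + 1, so division becomes legitimate.\<close>
      have "enn2real (moment_inf M X (real n)) > 0"
        using moment_inf_pos[of "real n"] fin by (simp add: enn2real_positive_iff)
      with rec have "levy_exponent (real (Suc n)) \<noteq> 0" by auto
      then have "enn2real (moment_inf M X (real (Suc n))) =
          real (Suc n) * enn2real (moment_inf M X (real n)) / levy_exponent (real (Suc n))"
        using rec by (rule eq_divide_imp)
      then show ?thesis using IH by (simp add: prod.nat_ivl_Suc')
    qed
    ultimately show ?case by blast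
  qed
  then show "q > 0 \<Longrightarrow> enn2real (laplace_carson q (moment M X (real n))) = fact n / (\<Prod>k=1..n. q + levy_exponent (real k))"
    "enn2real (moment_inf M X (real n)) = fact n / (\<Prod>k=1..n. levy_exponent (real k))"
    by blast+
qed

text \<open>\<open>enn2real\<close> sends \<infinity> to 0, so ordinary powers represent the moments
  only where the functional is finite; the finite first moment gives this almost surely.\<close>

lemma moment_inf_eq_power:
  assumes fin: "moment_inf M X (real n) < \<infinity>" "moment_inf M X 1 < \<infinity>"
  shows "integrable M (\<lambda>\<omega>. enn2real (exp_functional_inf X \<omega>) ^ n)"
    and "expectation (\<lambda>\<omega>. enn2real (exp_functional_inf X \<omega>) ^ n) = enn2real (moment_inf M X (real n))"
proof -
  have "AE \<omega> in M. ennreal_powr (exp_functional_inf X \<omega>) 1 \<noteq> \<infinity>"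
    using fin(2) unfolding moment_inf_def by (intro nn_integral_PInf_AE) auto
  then have "AE \<omega> in M. ennreal_powr (exp_functional_inf X \<omega>) (real n) = ennreal (enn2real (exp_functional_inf X \<omega>) ^ n)"
  proof eventually_elim
    case (elim \<omega>)
    then have "exp_functional_inf X \<omega> \<noteq> \<infinity>" by (auto simp: ennreal_powr_def)
    moreover have "enn2real (exp_functional_inf X \<omega>) powr real n = enn2real (exp_functional_inf X \<omega>) ^ n" if "n > 0"
      using that by (intro powr_realpow') auto
    ultimately show ?case by (auto simp: ennreal_powr_def)
  qed
  then have eq: "(\<integral>\<^sup>+\<omega>. ennreal (enn2real (exp_functional_inf X \<omega>) ^ n) \<partial>M) = moment_inf M X (real n)"
    unfolding moment_inf_def by (intro nn_integral_cong_AE) auto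
  then show "integrable M (\<lambda>\<omega>. enn2real (exp_functional_inf X \<omega>) ^ n)"
    using fin(1) by (intro integrableI_nonneg) auto
  show "expectation (\<lambda>\<omega>. enn2real (exp_functional_inf X \<omega>) ^ n) = enn2real (moment_inf M X (real n))"
    unfolding eq[symmetric] by (intro integral_eq_nn_integral) auto
qed

text \<open>
  The partial sums of the exponential series alternately bound \<open>exp (- x)\<close> from below and above, so
  no domination is needed to exchange sum and expectation, even on the boundary of convergence.
\<close>

lemma laplace_transform_exp_functional_inf:
  assumes tail: "\<And>n::nat. n \<ge> 1 \<Longrightarrow> exp_tail_condition K\<^sub>0 (real n)"
    and fin: "\<And>\<alpha>::real. \<alpha> > 0 \<Longrightarrow> moment_inf M X \<alpha> < \<infinity>"
    and \<beta>: "\<beta> \<ge> 0"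
    and summable: "summable (\<lambda>n. (-1) ^ n * \<beta> ^ n / (\<Prod>k=1..n. levy_exponent (real k)))"
  shows "expectation (\<lambda>\<omega>. exp (- \<beta> * enn2real (exp_functional_inf X \<omega>))) =
    (\<Sum>n. (-1) ^ n * \<beta> ^ n / (\<Prod>k=1..n. levy_exponent (real k)))"
proof -
  define I where "I \<omega> = enn2real (exp_functional_inf X \<omega>)" for \<omega>
  define c where "c n = (-1) ^ n * \<beta> ^ n / (\<Prod>k=1..n. levy_exponent (real k))" for n
  have fin': "moment_inf M X (real n) < \<infinity>" for n :: nat
    using fin by (cases "n = 0") (auto simp: moment_inf_0)
  have I: "I \<omega> \<ge> 0" for \<omega> by (simp add: I_def)
  have [measurable]: "I \<in> borel_measurable M" unfolding I_def[abs_def] by measurable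
  have I_int: "integrable M (\<lambda>\<omega>. I \<omega> ^ n)" for n
    unfolding I_def using fin'[of n] fin'[of 1] by (intro moment_inf_eq_power) auto
  have I_moment: "expectation (\<lambda>\<omega>. I \<omega> ^ n) = fact n / (\<Prod>k=1..n. levy_exponent (real k))" for n
  proof (cases "n = 0")
    case False
    have "expectation (\<lambda>\<omega>. I \<omega> ^ n) = enn2real (moment_inf M X (real n))"
      unfolding I_def using fin'[of n] fin'[of 1] by (intro moment_inf_eq_power) auto
    with integer_moments(2)[OF tail[of n] fin'[of n]] False show ?thesis by simp
  qed (simp add: prob_space)
  have term_eq: "(- (\<beta> * I \<omega>)) ^ m / fact m = ((-1) ^ m * \<beta> ^ m / fact m) * I \<omega> ^ m" for m \<omega>
    by (subst power_minus) (simp add: power_mult_distrib)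
  have term_int: "integrable M (\<lambda>\<omega>. (- (\<beta> * I \<omega>)) ^ m / fact m)" for m
    unfolding term_eq using I_int by (rule integrable_mult_right)
  have term_expectation: "expectation (\<lambda>\<omega>. (- (\<beta> * I \<omega>)) ^ m / fact m) = c m" for m
    unfolding term_eq by (simp add: I_moment c_def)
  have partial: "expectation (\<lambda>\<omega>. \<Sum>m<n. (- (\<beta> * I \<omega>)) ^ m / fact m) = (\<Sum>m<n. c m)" for n
    by (simp only: Bochner_Integration.integral_sum[OF term_int] term_expectation)
  have exp_int: "integrable M (\<lambda>\<omega>. exp (- (\<beta> * I \<omega>)))"
    using I \<beta> by (intro integrable_const_bound[of _ 1]) auto
  have lim: "(\<lambda>n. \<Sum>m<n. c m) \<longlonglongrightarrow> (\<Sum>n. c n)"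
    using summable unfolding c_def by (rule summable_LIMSEQ)
  have lower: "(\<Sum>m<2 * n. c m) \<le> expectation (\<lambda>\<omega>. exp (- (\<beta> * I \<omega>)))" for n
    unfolding partial[symmetric] using I \<beta> term_int exp_int
    by (intro integral_mono exp_alternating_bounds(1)) auto
  have upper: "expectation (\<lambda>\<omega>. exp (- (\<beta> * I \<omega>))) \<le> (\<Sum>m<Suc (2 * n). c m)" for n
    unfolding partial[symmetric] using I \<beta> term_int exp_int
    by (intro integral_mono exp_alternating_bounds(2)) (auto simp del: sum.lessThan_Suc)
  \<comment> \<open>By summability the even and the odd partial sums have the same limit, which
    squeezes the expectation.\<close>
  have "(\<Sum>n. c n) \<le> expectation (\<lambda>\<omega>. exp (- (\<beta> * I \<omega>)))"
    using LIMSEQ_subseq_LIMSEQ[OF lim, of "\<lambda>n. 2 * n"] lower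
    by (intro LIMSEQ_le_const2) (auto simp: strict_mono_def comp_def)
  moreover have "expectation (\<lambda>\<omega>. exp (- (\<beta> * I \<omega>))) \<le> (\<Sum>n. c n)"
    using LIMSEQ_subseq_LIMSEQ[OF lim, of "\<lambda>n. Suc (2 * n)"] upper
    by (intro LIMSEQ_le_const) (auto simp: strict_mono_def comp_def simp del: sum.lessThan_Suc)
  ultimately show ?thesis by (simp add: I_def c_def)
qed

end

theorem corollary2:
  fixes M :: "'a measure" and X :: "real \<Rightarrow> 'a \<Rightarrow> real"
    and b\<^sub>0 c\<^sub>0 :: real and K\<^sub>0 :: "real measure"
  defines "\<Phi> \<equiv> laplace_exponent b\<^sub>0 c\<^sub>0 K\<^sub>0"
  assumes "levy_process_params M X b\<^sub>0 c\<^sub>0 K\<^sub>0"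
    and "(\<integral>\<^sup>+x\<in>-{0}. ennreal (min (x\<^sup>2) \<bar>x\<bar>) \<partial>K\<^sub>0) < \<infinity>"
  shows
    "(\<forall>\<alpha>::real. \<alpha> \<ge> 1 \<and> exp_tail_condition K\<^sub>0 \<alpha> \<and> moment_inf M X \<alpha> < \<infinity> \<longrightarrow>
        (\<forall>q::real. q > 0 \<longrightarrow>
          laplace_carson q (moment M X \<alpha>) < \<infinity> \<and>
          laplace_carson q (moment M X (\<alpha> - 1)) < \<infinity> \<and>
          enn2real (laplace_carson q (moment M X \<alpha>)) * (q + \<Phi> \<alpha>) =
            \<alpha> * enn2real (laplace_carson q (moment M X (\<alpha> - 1)))))
   \<and> (\<forall>n::nat. n \<ge> 1 \<and> exp_tail_condition K\<^sub>0 (real n) \<and> moment_inf M X (real n) < \<infinity> \<longrightarrow>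
        (\<forall>q::real. q > 0 \<longrightarrow>
          enn2real (laplace_carson q (moment M X (real n))) =
            fact n / (\<Prod>k=1..n. q + \<Phi> (real k))) \<and>
        enn2real (moment_inf M X (real n)) = fact n / (\<Prod>k=1..n. \<Phi> (real k)))
   \<and> (\<forall>\<beta>::real.
        (\<forall>n::nat. n \<ge> 1 \<longrightarrow> exp_tail_condition K\<^sub>0 (real n)) \<and>
        (\<forall>\<alpha>::real. \<alpha> > 0 \<longrightarrow> moment_inf M X \<alpha> < \<infinity>) \<and>
        \<beta> \<ge> 0 \<and>
        summable (\<lambda>n. (-1) ^ n * \<beta> ^ n / (\<Prod>k=1..n. \<Phi> (real k))) \<longrightarrow>
        (LINT \<omega>|M. exp (- \<beta> * enn2real (exp_functional_inf X \<omega>))) =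
          (\<Sum>n. (-1) ^ n * \<beta> ^ n / (\<Prod>k=1..n. \<Phi> (real k))))"
proof -
  interpret levy_process_finite_mean M X b\<^sub>0 c\<^sub>0 K\<^sub>0
    using assms(2,3) by (intro levy_process_finite_mean.intro levy_process_finite_mean_axioms.intro)
  have \<Phi>: "\<Phi> = levy_exponent"
    by (simp add: assms(1) levy_exponent_def)
  show ?thesis
    unfolding \<Phi>
    \<comment> \<open>Finiteness at \<alpha> - 1 comes before finiteness at \<alpha>: the former
      goal also matches the latter rule at \<alpha> - 1, whose hypothesis \<alpha> - 1 \<ge> 1 may
      fail.\<close>
    by (intro conjI allI impI; elim conjE;
        (rule laplace_carson_recursion(2) | rule laplace_carson_recursion(1) | rule laplace_carson_recursion(4) |
         rule integer_moments(1) | rule integer_moments(2) | rule laplace_transform_exp_functional_inf); simp)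
qed

end
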